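(* Let $n\ge 2$ be an integer, let $d>0$, and let $a_n, c_{2n-2}\in\mathbb{R}$ satisfy $$c_{2n-2}>0,\qquad \kappa(a_n)>\max\left\{\xi_0,\ \left(\frac12+\frac1{2n}\right)\xi_0+\frac14-\frac1{4n}\right\},$$ where $\kappa(a_n)=\frac{1}{\Delta}\left(\Delta'_1\frac{(-1)^{n-1}}{(n-1)!}a_n+\Delta''_1\right)$ and $\xi_0$ is the root of the equation $$\left|\begin{array}{cccc}\left(1+\frac1n\right)\xi_0+\frac12-\frac1{2n}&\frac12&\cdots&\frac1n\\ \frac12&\frac13&\cdots&\frac1{n+1}\\ \vdots&\vdots&&\vdots\\ \frac1n&\frac1{n+1}&\cdots&\frac1{2n-1}\end{array}\right|=0 .$$ Let $C$ and $a=(a_1,\ldots,a_n)^*$ be the matrix and vector determined by $a_n$ and $c_{2n-2}$ as in the context, let $F=D_n^{-1}C^{-1}D_n^{-1}$ (so $F^{-1}=D_nCD_n$), and let $a_0$ satisfy $$0<a_0\le\frac{d^2}{2(F^{-1}a,a)} .$$ Let the controllability function $\Theta$ be defined by $\Theta(0)=0$ and, for $x\neq0$, by letting $\Theta(x)$ be the positive solution $\Theta$ of the equation $$2a_0\Theta=(D(\Theta)FD(\Theta)x,x).$$ Then the control $$u(x)=\sum_{k=1}^n\frac{a_kx_k}{\Theta^k(x)}$$ transfers an arbitrary initial point $x\in\mathbb{R}^n$ to the origin along the trajectory of the system $\dot x=A_0x+b_0u(x)$ in time $T(x)=\Theta(x)$, and it satisfies the restriction $|u(x)|\le d$.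
   Context: $(\cdot,\cdot)$ is the standard inner product on $\mathbb{R}^n$ and $^*$ denotes transpose. $A_0$ is the $n\times n$ matrix with entries $(A_0)_{i+1,i}=1$ for $i=1,\ldots,n-1$ and all other entries $0$; $b_0=(1,0,\ldots,0)^*\in\mathbb{R}^n$. Thus $\dot x=A_0x+b_0u$ is the canonical system $\dot x_1=u$, $\dot x_i=x_{i-1}$ for $i=2,\ldots,n$. For $\Theta>0$, $D(\Theta)=\mathrm{diag}\left(\Theta^{-\frac{2i-1}{2}}\right)_{i=1}^n$. Also $D_n=\mathrm{diag}\left(\frac{(-1)^{i-1}}{(i-1)!}\right)_{i=1}^n$. Set $a_1=-\frac{n(n+1)}2$. Let $\widetilde P$ be the $(n-1)\times(n-1)$ matrix whose first column is $(-1,0,\ldots,0)^*$ and whose $(i,j)$ entry for $1\le i\le n-1$, $2\le j\le n-1$ is $\frac1{(i+j)(i+j+1)}$; it is nonsingular, and $\Delta=\det\widetilde P$. Let $d',d''\in\mathbb{R}^{n-1}$ be the vectors with components $d'_i=-\frac1{(n+i)(n+i+1)}$ for $1\le i\le n-1$, $d''_1=-\frac{3+a_1}{2\cdot3}$, and $d''_i=-\frac{a_1}{(i+1)(i+2)}$ for $2\le i\le n-1$. For $j=1,\ldots,n-1$, $\Delta'_j$ (respectively $\Delta''_j$) is the determinant of the matrix obtained from $\widetilde P$ by replacing its $j$-th column by $d'$ (respectively $d''$). Given real parameters $a_n$ and $c_{2n-2}$, the vector $a=(a_1,\ldots,a_n)^*$ has first component $a_1=-\frac{n(n+1)}2$,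 last component $a_n$, and $$a_j=(-1)^{j-1}(j-1)!\,\frac1\Delta\left(\Delta'_j\frac{(-1)^{n-1}}{(n-1)!}a_n+\Delta''_j\right),\qquad 2\le j\le n-1.$$ The symmetric $n\times n$ matrix $C$ has entries $C_{11}=(2n-1)2n\,c_{2n-2}\,\kappa(a_n)$, with $\kappa(a_n)=\frac{1}{\Delta}\left(\Delta'_1\frac{(-1)^{n-1}}{(n-1)!}a_n+\Delta''_1\right)$, and $C_{ij}=\frac{(2n-1)2n\,c_{2n-2}}{(i+j-1)(i+j)}$ for $(i,j)\ne(1,1)$. *)

theory Defs
  imports Complex_Main "Jordan_Normal_Form.Determinant" "Jordan_Normal_Form.Gauss_Jordan_Elimination"
begin

text \<open>
  Vectors and matrices of \<open>Jordan_Normal_Form\<close> are indexed from 0. The next two constructors take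
  the entries as functions of indices running from 1.
\<close>

definition mat1 :: "nat \<Rightarrow> nat \<Rightarrow> (nat \<Rightarrow> nat \<Rightarrow> real) \<Rightarrow> real mat" where
  "mat1 r c f = mat r c (\<lambda>(i, j). f (i + 1) (j + 1))"

definition vec1 :: "nat \<Rightarrow> (nat \<Rightarrow> real) \<Rightarrow> real vec" where
  "vec1 m f = vec m (\<lambda>i. f (i + 1))"

text \<open>Only meaningful for nonsingular \<open>A\<close>; otherwise an unspecified matrix.\<close>

definition mat_inv :: "real mat \<Rightarrow> real mat" where
  "mat_inv A = the (mat_inverse A)"

subsection \<open>The canonical system\<close>

definition A0_mat :: "nat \<Rightarrow> real mat" where
  "A0_mat n = mat1 n n (\<lambda>i j. if i = j + 1 then 1 else 0)"

definition b0_vec :: "nat \<Rightarrow> real vec" where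
  "b0_vec n = vec1 n (\<lambda>i. if i = 1 then 1 else 0)"

definition D_Theta :: "nat \<Rightarrow> real \<Rightarrow> real mat" where
  "D_Theta n \<theta> = mat1 n n (\<lambda>i j. if i = j then \<theta> powr (- ((2 * real i - 1) / 2)) else 0)"

definition D_mat :: "nat \<Rightarrow> real mat" where
  "D_mat n = mat1 n n (\<lambda>i j. if i = j then (-1) ^ (i - 1) / fact (i - 1) else 0)"

subsection \<open>The parameters of the control\<close>

definition a_first :: "nat \<Rightarrow> real" where
  "a_first n = - (real n * (real n + 1) / 2)"

definition P_tilde :: "nat \<Rightarrow> real mat" where
  "P_tilde n = mat1 (n - 1) (n - 1)
     (\<lambda>i j. if j = 1 then (if i = 1 then - 1 else 0)
            else 1 / ((real i + real j) * (real i + real j + 1)))"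

definition d' :: "nat \<Rightarrow> real vec" where
  "d' n = vec1 (n - 1) (\<lambda>i. - (1 / ((real n + real i) * (real n + real i + 1))))"

definition d'' :: "nat \<Rightarrow> real vec" where
  "d'' n = vec1 (n - 1)
     (\<lambda>i. if i = 1 then - ((3 + a_first n) / (2 * 3))
          else - (a_first n / ((real i + 1) * (real i + 2))))"

definition Delta :: "nat \<Rightarrow> real" where
  "Delta n = det (P_tilde n)"

definition Delta' :: "nat \<Rightarrow> nat \<Rightarrow> real" where
  "Delta' n j = det (replace_col (P_tilde n) (d' n) (j - 1))"

definition Delta'' :: "nat \<Rightarrow> nat \<Rightarrow> real" where
  "Delta'' n j = det (replace_col (P_tilde n) (d'' n) (j - 1))"

definition kappa :: "nat \<Rightarrow> real \<Rightarrow> real" where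
  "kappa n an = 1 / Delta n * (Delta' n 1 * ((-1) ^ (n - 1) / fact (n - 1)) * an + Delta'' n 1)"

definition a_vec :: "nat \<Rightarrow> real \<Rightarrow> real vec" where
  "a_vec n an = vec1 n
     (\<lambda>j. if j = 1 then a_first n
          else if j = n then an
          else (-1) ^ (j - 1) * fact (j - 1) * (1 / Delta n) *
                 (Delta' n j * ((-1) ^ (n - 1) / fact (n - 1)) * an + Delta'' n j))"

text \<open>The argument \<open>c\<close> is the parameter \<open>c\<^bsub>2n-2\<^esub>\<close>.\<close>

definition C_mat :: "nat \<Rightarrow> real \<Rightarrow> real \<Rightarrow> real mat" where
  "C_mat n an c = mat1 n n
     (\<lambda>i j. if i = 1 \<and> j = 1 then (2 * real n - 1) * (2 * real n) * c * kappa n an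
            else (2 * real n - 1) * (2 * real n) * c /
                   ((real i + real j - 1) * (real i + real j)))"

definition xi_mat :: "nat \<Rightarrow> real \<Rightarrow> real mat" where
  "xi_mat n \<xi> = mat1 n n
     (\<lambda>i j. if i = 1 \<and> j = 1 then (1 + 1 / real n) * \<xi> + 1 / 2 - 1 / (2 * real n)
            else 1 / (real i + real j - 1))"

subsection \<open>Controllability function and control\<close>

definition Theta_eq :: "nat \<Rightarrow> real mat \<Rightarrow> real \<Rightarrow> real vec \<Rightarrow> real \<Rightarrow> bool" where
  "Theta_eq n F a\<^sub>0 x \<theta> \<longleftrightarrow>
     2 * a\<^sub>0 * \<theta> = ((D_Theta n \<theta> * F * D_Theta n \<theta>) *\<^sub>v x) \<bullet> x"

definition controllability_fun :: "nat \<Rightarrow> real mat \<Rightarrow> real \<Rightarrow> real vec \<Rightarrow> real" where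
  "controllability_fun n F a\<^sub>0 x =
     (if x = 0\<^sub>v n then 0 else (THE \<theta>. \<theta> > 0 \<and> Theta_eq n F a\<^sub>0 x \<theta>))"

text \<open>
  At \<open>x = 0\<close> the formula for the control is meaningless on paper; here division by zero makes
  its value 0.
\<close>

definition control :: "nat \<Rightarrow> real vec \<Rightarrow> (real vec \<Rightarrow> real) \<Rightarrow> real vec \<Rightarrow> real" where
  "control n a \<Theta> x = (\<Sum>k = 1..n. a $ (k - 1) * x $ (k - 1) / \<Theta> x ^ k)"

text \<open>
  A solution of the closed-loop system on \<open>[0, s)\<close> starting at \<open>x\<^sub>0\<close>. The feedback is only defined
  away from the origin, so solutions live in the punctured space. Type \<open>real vec\<close> carries no
  topology, hence derivatives and continuity are taken componentwise; at time 0 the derivative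
  is one-sided.
\<close>

definition closed_loop_solution ::
    "nat \<Rightarrow> (real vec \<Rightarrow> real) \<Rightarrow> real vec \<Rightarrow> real \<Rightarrow> (real \<Rightarrow> real vec) \<Rightarrow> bool" where
  "closed_loop_solution n u x\<^sub>0 s \<phi> \<longleftrightarrow>
     \<phi> 0 = x\<^sub>0 \<and>
     (\<forall>t\<in>{0..<s}. \<phi> t \<in> carrier_vec n \<and> \<phi> t \<noteq> 0\<^sub>v n \<and>
        (\<forall>i<n. ((\<lambda>\<tau>. \<phi> \<tau> $ i) has_real_derivative
            (A0_mat n *\<^sub>v \<phi> t + u (\<phi> t) \<cdot>\<^sub>v b0_vec n) $ i) (at t within {0..<s})))"

text \<open>
  The control \<open>u\<close> steers \<open>x\<^sub>0\<close> to the origin in time \<open>T\<close>: there is a trajectory from \<open>x\<^sub>0\<close> which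
  first meets the origin at time \<open>T\<close>, and it is \<^emph>\<open>the\<close> trajectory, in that every solution
  starting at \<open>x\<^sub>0\<close> is a restriction of it. For \<open>x\<^sub>0 = 0\<close> this forces \<open>T = 0\<close>.
\<close>

definition transfers_to_origin ::
    "nat \<Rightarrow> (real vec \<Rightarrow> real) \<Rightarrow> real vec \<Rightarrow> real \<Rightarrow> bool" where
  "transfers_to_origin n u x\<^sub>0 T \<longleftrightarrow> T \<ge> 0 \<and>
     (\<exists>\<phi>. closed_loop_solution n u x\<^sub>0 T \<phi> \<and>
          (\<forall>i<n. continuous_on {0..T} (\<lambda>t. \<phi> t $ i)) \<and>
          \<phi> T = 0\<^sub>v n \<and>
          (\<forall>s > 0. \<forall>\<psi>. closed_loop_solution n u x\<^sub>0 s \<psi> \<longrightarrow>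
             s \<le> T \<and> (\<forall>t\<in>{0..<s}. \<psi> t = \<phi> t)))"

end

theory Submission
  imports Defs
begin

text \<open>
  In the variables \<open>y\<^sub>k = x\<^sub>k / \<Theta>^k\<close> the equation for \<open>\<Theta>\<close> reads \<open>(F y, y) = 2 a\<^sub>0\<close>, and the control is
  the linear function \<open>u = (a, y)\<close>. As long as \<open>\<Theta>\<close> decreases at unit speed, the closed loop becomes
  \<open>\<Theta> y' = M y\<close> with \<open>M = A\<^sub>0 + b\<^sub>0 a\<^sup>* + N\<close>, \<open>N = diag(1, \<dots>, n)\<close>. Everything rests on two properties of
  \<open>G = F\<^sup>-\<^sup>1 = D\<^sub>n C D\<^sub>n\<close>.

  The matrix \<open>M G\<close> is skew symmetric (\<open>drift_form_antisym\<close>), so \<open>M\<close> conserves \<open>(F y, y)\<close>. Away from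
  the first row and column this is an elementary identity for the entries of \<open>C\<close>. The first row
  and column give \<open>n\<close> linear equations (\<open>a_vec_system\<close>); all but one are solved by Cramer's rule, which
  is the definition of \<open>a\<close> and \<open>\<kappa>\<close>, and the remaining one holds for \<open>a\<^sub>1 = - n (n + 1) / 2\<close> by an
  orthogonality relation of Jacobi polynomials (\<open>first_row_from_others\<close>).

  The matrix \<open>N G + G N\<close> is positive definite. After removing \<open>D\<^sub>n\<close> and constant factors it is the
  Hilbert matrix with corner entry \<open>2 \<kappa>\<close>, and the equation for \<open>\<xi>\<^sub>0\<close> says which corner entry makes the
  Hilbert matrix singular; a larger one makes it positive definite
  (\<open>pos_def_form_above_singular_corner\<close>). Then \<open>G\<close> is positive definite as well, being an integral of
  dilated copies of \<open>N G + G N\<close> (\<open>form_pos_by_scaling\<close>).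

  Positive definiteness of \<open>N G + G N\<close> makes \<open>(F y, y)\<close> strictly decreasing in \<open>\<Theta>\<close>, so \<open>\<Theta>(x)\<close> exists and is
  unique (\<open>ex1_level\<close>). Implicit differentiation along any closed-loop solution, using the conservation
  law, gives \<open>\<Theta>' = - 1\<close> (\<open>rate_has_derivative\<close>). Hence a solution lasts at most the time \<open>\<Theta>(x)\<close>.
  Uniqueness follows because the rescaled difference of two solutions conserves a positive definite form, and
  existence because the flow of \<open>M\<close>, run in logarithmic time, can be scaled back
  (\<open>solution_unique\<close>, \<open>solution_exists\<close>). Finally \<open>u\<^sup>2 = (a, y)\<^sup>2 \<le> (F\<^sup>-\<^sup>1 a, a) (F y, y) \<le> d\<^sup>2\<close> by
  Cauchy-Schwarz.
\<close>

section \<open>Quadratic forms in finitely many coordinates\<close>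

definition bform :: "nat \<Rightarrow> (nat \<Rightarrow> nat \<Rightarrow> real) \<Rightarrow> (nat \<Rightarrow> real) \<Rightarrow> (nat \<Rightarrow> real) \<Rightarrow> real" where
  "bform n b x y = (\<Sum>i<n. \<Sum>j<n. b i j * x i * y j)"

lemma bform_cong:
  assumes "\<And>i j. i < n \<Longrightarrow> j < n \<Longrightarrow> b i j * x i * y j = b' i j * x' i * y' j"
  shows "bform n b x y = bform n b' x' y'"
  unfolding bform_def using assms by (intro sum.cong refl) auto

lemma bform_add_left: "bform n b (\<lambda>i. x i + x' i) y = bform n b x y + bform n b x' y"
  by (simp add: bform_def algebra_simps sum.distrib)

lemma bform_add_right: "bform n b x (\<lambda>i. y i + y' i) = bform n b x y + bform n b x y'"
  by (simp add: bform_def algebra_simps sum.distrib)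

lemma bform_add_coeff: "bform n (\<lambda>i j. b i j + b' i j) x y = bform n b x y + bform n b' x y"
  by (simp add: bform_def algebra_simps sum.distrib)

lemma bform_scale_left: "bform n b (\<lambda>i. c * x i) y = c * bform n b x y"
  by (simp add: bform_def sum_distrib_left mult_ac)

lemma bform_scale_right: "bform n b x (\<lambda>i. c * y i) = c * bform n b x y"
  by (simp add: bform_def sum_distrib_left mult_ac)

lemma bform_scale_coeff: "bform n (\<lambda>i j. c * b i j) x y = c * bform n b x y"
  by (simp add: bform_def sum_distrib_left mult_ac)

lemma bform_swap: "bform n b x y = bform n (\<lambda>i j. b j i) y x"
  unfolding bform_def by (subst sum.swap) (simp add: mult_ac)

lemma bform_commute:
  assumes "\<And>i j. i < n \<Longrightarrow> j < n \<Longrightarrow> b i j = b j i"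
  shows "bform n b x y = bform n b y x"
  by (subst bform_swap, rule bform_cong) (simp add: assms)

lemma bform_zero: "(\<And>i. i < n \<Longrightarrow> x i = 0) \<Longrightarrow> bform n b x y = 0"
  unfolding bform_def by simp

text \<open>
  The coefficients need not be symmetric, so \<open>diag(1, \<dots>, n) F\<close> can be called positive definite
  without passing to its symmetric part.
\<close>

definition pos_def_form :: "nat \<Rightarrow> (nat \<Rightarrow> nat \<Rightarrow> real) \<Rightarrow> bool" where
  "pos_def_form n b \<longleftrightarrow> (\<forall>x. (\<exists>i<n. x i \<noteq> 0) \<longrightarrow> bform n b x x > 0)"

lemma pos_def_formD: "pos_def_form n b \<Longrightarrow> i < n \<Longrightarrow> x i \<noteq> 0 \<Longrightarrow> bform n b x x > 0"
  unfolding pos_def_form_def by blast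

lemma pos_def_form_nonneg:
  assumes "pos_def_form n b" shows "bform n b x x \<ge> 0"
proof (cases "\<exists>i<n. x i \<noteq> 0")
  case True
  then show ?thesis using assms unfolding pos_def_form_def by (simp add: less_imp_le)
next
  case False
  then show ?thesis by (subst bform_zero) auto
qed

text \<open>
  Minimise the nonnegative quadratic \<open>t \<mapsto> b(x + t y, x + t y)\<close>.
\<close>

lemma pos_def_form_Cauchy_Schwarz:
  assumes sym: "\<And>i j. i < n \<Longrightarrow> j < n \<Longrightarrow> b i j = b j i" and pd: "pos_def_form n b"
  shows "(bform n b x y)\<^sup>2 \<le> bform n b x x * bform n b y y"
proof (cases "\<exists>i<n. y i \<noteq> 0")
  case True
  then have yy: "bform n b y y > 0" using pd unfolding pos_def_form_def by blast
  define t where "t = - bform n b x y / bform n b y y"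
  have "0 \<le> bform n b (\<lambda>i. x i + t * y i) (\<lambda>i. x i + t * y i)"
    by (rule pos_def_form_nonneg[OF pd])
  also have "\<dots> = bform n b x x + 2 * t * bform n b x y + t\<^sup>2 * bform n b y y"
    using bform_commute[of n b y x, OF sym]
    by (simp add: bform_add_left bform_add_right bform_scale_left bform_scale_right
        power2_eq_square algebra_simps)
  also have "\<dots> = bform n b x x - (bform n b x y)\<^sup>2 / bform n b y y"
    using yy by (simp add: t_def power2_eq_square field_simps)
  finally show ?thesis using yy by (simp add: field_simps)
next
  case False
  then have "bform n b y x = 0" by (intro bform_zero) auto
  then have "bform n b x y = 0" using bform_commute[of n b x y, OF sym] by simp
  then show ?thesis by (simp add: pos_def_form_nonneg[OF pd])
qed

section \<open>Forms of Hilbert type\<close>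

text \<open>
  Dividing coefficients by \<open>i + j + c\<close> is integration along the dilations \<open>v\<^sub>i \<mapsto> s\<^sup>i v\<^sub>i\<close>:
  the new form at \<open>v\<close> is the integral over \<open>0 < s < 1\<close> of \<open>s^(c - 1)\<close> times the old form at the
  dilated vector. The proof replaces the integral by the monotonicity of its antiderivative, so
  that one point where the integrand is positive is enough for strictness.
\<close>

lemma form_pos_by_scaling:
  fixes b :: "nat \<Rightarrow> nat \<Rightarrow> real" and v :: "nat \<Rightarrow> real"
  assumes c: "c \<ge> 1"
    and nonneg: "\<And>s. bform n b (\<lambda>i. s ^ i * v i) (\<lambda>i. s ^ i * v i) \<ge> 0"
    and s0: "0 < s\<^sub>0" "s\<^sub>0 < 1" "bform n b (\<lambda>i. s\<^sub>0 ^ i * v i) (\<lambda>i. s\<^sub>0 ^ i * v i) > 0"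
  shows "bform n (\<lambda>i j. b i j / real (i + j + c)) v v > 0"
proof -
  define \<phi> where "\<phi> s = (\<Sum>i<n. \<Sum>j<n. b i j / real (i + j + c) * v i * v j * s ^ (i + j + c))" for s
  have der: "(\<phi> has_real_derivative s ^ (c - 1) * bform n b (\<lambda>i. s ^ i * v i) (\<lambda>i. s ^ i * v i)) (at s)"
    for s
  proof -
    have "(\<phi> has_real_derivative
       (\<Sum>i<n. \<Sum>j<n. b i j / real (i + j + c) * v i * v j * (real (i + j + c) * s ^ (i + j + c - 1)))) (at s)"
      unfolding \<phi>_def using c by (auto intro!: derivative_eq_intros sum.cong)
    also have "(\<Sum>i<n. \<Sum>j<n. b i j / real (i + j + c) * v i * v j * (real (i + j + c) * s ^ (i + j + c - 1)))
      = s ^ (c - 1) * bform n b (\<lambda>i. s ^ i * v i) (\<lambda>i. s ^ i * v i)"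
      unfolding bform_def sum_distrib_left
    proof (intro sum.cong refl)
      fix i j
      have "s ^ (i + j + c - 1) = s ^ (c - 1) * s ^ i * s ^ j"
        using c by (simp add: add_ac flip: power_add)
      then show "b i j / real (i + j + c) * v i * v j * (real (i + j + c) * s ^ (i + j + c - 1)) =
        s ^ (c - 1) * (b i j * (s ^ i * v i) * (s ^ j * v j))"
        using c by (simp del: of_nat_add)
    qed
    finally show ?thesis .
  qed
  have mono: "\<phi> s \<le> \<phi> t" if "0 \<le> s" "s \<le> t" for s t
    using that(2)
  proof (rule DERIV_nonneg_imp_nondecreasing)
    fix r assume "s \<le> r" "r \<le> t"
    then show "\<exists>y. (\<phi> has_real_derivative y) (at r) \<and> 0 \<le> y"
      using der[of r] nonneg[of r] that
      by (intro exI[of _ "r ^ (c - 1) * bform n b (\<lambda>i. r ^ i * v i) (\<lambda>i. r ^ i * v i)"]) auto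
  qed
  obtain d where d: "d > 0" "\<And>h. 0 < h \<Longrightarrow> h < d \<Longrightarrow> \<phi> s\<^sub>0 < \<phi> (s\<^sub>0 + h)"
    using DERIV_pos_inc_right[OF der[of s\<^sub>0]] s0 by auto
  define h where "h = min (d / 2) (1 - s\<^sub>0)"
  have h: "0 < h" "h < d" "s\<^sub>0 + h \<le> 1" using d s0 by (auto simp: h_def min_def)
  have "0 = \<phi> 0" using c unfolding \<phi>_def by (simp add: power_0_left)
  also have "\<dots> \<le> \<phi> s\<^sub>0" using mono s0 by simp
  also have "\<phi> s\<^sub>0 < \<phi> (s\<^sub>0 + h)" using d h by simp
  also have "\<dots> \<le> \<phi> 1" using mono h s0 by simp
  finally show ?thesis by (simp add: \<phi>_def bform_def)
qed

text \<open>
  This passes from the Hilbert matrix to entries with two consecutive denominators, as they occur in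
  \<open>P_tilde\<close> and \<open>C\<close>.
\<close>

lemma pos_def_form_divide:
  assumes "c \<ge> 1" and "pos_def_form n b"
  shows "pos_def_form n (\<lambda>i j. b i j / real (i + j + c))"
  unfolding pos_def_form_def
proof (intro allI impI)
  fix v :: "nat \<Rightarrow> real" assume "\<exists>i<n. v i \<noteq> 0"
  then obtain i where "i < n" "v i \<noteq> 0" by blast
  then show "bform n (\<lambda>i j. b i j / real (i + j + c)) v v > 0"
    by (intro form_pos_by_scaling[where s\<^sub>0 = "1/2"] assms(1) pos_def_form_nonneg[OF assms(2)]
        pos_def_formD[OF assms(2), of i]) auto
qed

text \<open>
  Here the dilated form is that of the all-ones matrix, the square of a polynomial in \<open>s\<close>. It is
  only semidefinite, but a nonzero polynomial has finitely many roots.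
\<close>

lemma pos_def_form_Hilbert:
  assumes "c \<ge> 1"
  shows "pos_def_form n (\<lambda>i j. 1 / real (i + j + c))"
  unfolding pos_def_form_def
proof (intro allI impI)
  fix v :: "nat \<Rightarrow> real" assume "\<exists>i<n. v i \<noteq> 0"
  then obtain k where k: "k < n" "v k \<noteq> 0" by blast
  have sq: "bform n (\<lambda>i j. 1) (\<lambda>i. s ^ i * v i) (\<lambda>i. s ^ i * v i) = (\<Sum>i<n. v i * s ^ i)\<^sup>2" for s
    by (simp add: bform_def power2_eq_square sum_product mult_ac)
  have "finite {s. (\<Sum>i\<le>n - 1. v i * s ^ i) = 0}"
    using k by (subst polyfun_finite_roots) (auto intro!: exI[of _ k])
  moreover have "{..n - 1} = {..<n}" using k by auto
  ultimately have "finite {s. (\<Sum>i<n. v i * s ^ i) = 0}" by simp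
  moreover have "infinite {0<..<1::real}" by simp
  ultimately have "\<not> {0<..<1} \<subseteq> {s. (\<Sum>i<n. v i * s ^ i) = 0}"
    using finite_subset by blast
  then obtain s where "s \<in> {0<..<1}" "(\<Sum>i<n. v i * s ^ i) \<noteq> 0" by blast
  then show "bform n (\<lambda>i j. 1 / real (i + j + c)) v v > 0"
    by (intro form_pos_by_scaling[where s\<^sub>0 = s] assms) (auto simp: sq)
qed

section \<open>Alternating binomial sums and orthogonality\<close>

text \<open>
  An \<open>m\<close>-th finite difference annihilates polynomials of degree below \<open>m\<close>. Stating it for products of
  linear factors, with a shift \<open>x\<close>, makes the induction on the number of factors close: the
  leading part of a factor is absorbed by \<open>r (m choose r) = m (m - 1 choose r - 1)\<close>.
\<close>

lemma alternating_binomial_prod: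
  fixes x :: real and c :: "'a \<Rightarrow> real"
  assumes "finite J" "card J < m"
  shows "(\<Sum>r\<le>m. (-1) ^ r * real (m choose r) * (\<Prod>i\<in>J. x + real r + c i)) = 0"
  using assms
proof (induction J arbitrary: m x rule: finite_induct)
  case empty
  then show ?case using choose_alternating_sum[of m, where ?'a = real] by simp
next
  case (insert j J)
  then obtain m' where m: "m = Suc m'" "card J < m'" by (cases m) auto
  define P where "P x r = (\<Prod>i\<in>J. x + real r + c i)" for x r
  have P_shift: "P x (Suc r) = P (x + 1) r" for x r by (simp add: P_def add_ac)
  have "(\<Sum>r\<le>m. (-1) ^ r * real (m choose r) * (\<Prod>i\<in>insert j J. x + real r + c i))
      = (\<Sum>r\<le>m. (-1) ^ r * (real r * real (m choose r)) * P x r)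
        + (x + c j) * (\<Sum>r\<le>m. (-1) ^ r * real (m choose r) * P x r)"
    using insert.hyps
    by (simp add: P_def sum_distrib_left flip: sum.distrib) (simp add: algebra_simps)
  also have "(\<Sum>r\<le>m. (-1) ^ r * real (m choose r) * P x r) = 0"
    unfolding P_def using insert.IH[of m x] m by simp
  also have "(\<Sum>r\<le>m. (-1) ^ r * (real r * real (m choose r)) * P x r)
      = (\<Sum>r\<le>m'. (-1) ^ Suc r * (real (Suc r) * real (Suc m' choose Suc r)) * P x (Suc r))"
    unfolding m(1) by (subst sum.atMost_Suc_shift) simp
  also have "\<dots> = - real m * (\<Sum>r\<le>m'. (-1) ^ r * real (m' choose r) * P (x + 1) r)"
    unfolding sum_distrib_left
  proof (intro sum.cong refl)
    fix r
    have "real (Suc r) * real (Suc m' choose Suc r) = real m * real (m' choose r)"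
      unfolding m(1) by (metis Suc_times_binomial of_nat_mult)
    then show "(-1) ^ Suc r * (real (Suc r) * real (Suc m' choose Suc r)) * P x (Suc r) =
      - real m * ((-1) ^ r * real (m' choose r) * P (x + 1) r)"
      by (simp add: P_shift)
  qed
  also have "(\<Sum>r\<le>m'. (-1) ^ r * real (m' choose r) * P (x + 1) r) = 0"
    unfolding P_def using insert.IH[of m' "x + 1"] m by simp
  finally show ?case by simp
qed

text \<open>
  Up to a constant factor, \<open>jacobi_weight n r\<close> is the coefficient of \<open>t^(r - 1)\<close> in the polynomial of
  degree \<open>n - 1\<close> that is orthogonal to \<open>t, \<dots>, t^(n - 1)\<close> on \<open>[0, 1]\<close> with weight \<open>1 - t\<close>. The inner
  product of \<open>t^(r - 1)\<close> and \<open>t^k\<close> is \<open>1 / ((r + k) (r + k + 1))\<close>.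
\<close>

definition jacobi_weight :: "nat \<Rightarrow> nat \<Rightarrow> real" where
  "jacobi_weight n r = (-1) ^ r * real (n choose r) * (\<Prod>i\<le>n. real r + real i)"

text \<open>
  The denominator cancels the two factors \<open>r + k\<close> and \<open>r + k + 1\<close> of the weight and leaves a polynomial
  of degree \<open>n - 1\<close> in \<open>r\<close>, whose alternating binomial sum over \<open>0 \<le> r \<le> n\<close> vanishes. The term
  \<open>r = 0\<close> contains the factor 0 unless \<open>k = 0\<close>, and then it is \<open>n!\<close>.
\<close>

lemma sum_jacobi_weight:
  assumes k: "k < n"
  shows "(\<Sum>r = 1..n. jacobi_weight n r / (real (r + k) * real (r + k + 1)))
    = (if k = 0 then - fact n else 0)"
proof -
  define J where "J = {..n} - {k, Suc k}"
  define P where "P r = (\<Prod>i\<in>J. real r + real i)" for r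
  have card_J: "card J = n - 1" using k by (simp add: J_def card_Diff_subset)
  have factor: "(\<Prod>i\<le>n. real r + real i) = real (r + k) * real (r + k + 1) * P r" for r
  proof -
    have "{..n} = insert k (insert (Suc k) J)" using k by (auto simp: J_def)
    moreover have "k \<notin> insert (Suc k) J" "Suc k \<notin> J" "finite J" by (auto simp: J_def)
    ultimately show ?thesis by (simp add: P_def algebra_simps)
  qed
  have P0: "P 0 = (if k = 0 then fact n else 0)"
  proof (cases "k = 0")
    case True
    have "{1..n} = insert 1 J" using k True by (auto simp: J_def)
    then have "(\<Prod>i = 1..n. real i) = P 0" using True by (simp add: P_def J_def)
    then show ?thesis using True by (simp add: fact_prod)
  next
    case False
    then have "0 \<in> J" using k by (auto simp: J_def)
    then show ?thesis using False by (auto simp: P_def J_def prod_zero_iff)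
  qed
  have "0 = (\<Sum>r\<le>n. (-1) ^ r * real (n choose r) * P r)"
    using alternating_binomial_prod[of J n 0 real] card_J k by (simp add: P_def J_def)
  also have "{..n} = insert 0 {1..n}" by auto
  also have "(\<Sum>r\<in>insert 0 {1..n}. (-1) ^ r * real (n choose r) * P r)
      = P 0 + (\<Sum>r = 1..n. (-1) ^ r * real (n choose r) * P r)" by simp
  also have "(\<Sum>r = 1..n. (-1) ^ r * real (n choose r) * P r)
      = (\<Sum>r = 1..n. jacobi_weight n r / (real (r + k) * real (r + k + 1)))"
    by (intro sum.cong refl) (simp add: jacobi_weight_def factor del: of_nat_add)
  finally show ?thesis using P0 by (auto split: if_splits)
qed

lemma jacobi_weight_1: "jacobi_weight n 1 = - real n * (real n + 1) * fact n"
proof -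
  have "(\<Prod>i\<le>n. 1 + real i) = fact (Suc n)"
    by (induction n) (auto simp: algebra_simps)
  then show ?thesis by (simp add: jacobi_weight_def)
qed

lemma jacobi_weight_2:
  "jacobi_weight n 2 = real n * (real n - 1) / 2 * (real n + 1) * (real n + 2) * fact n"
proof -
  have "(\<Prod>i\<le>n. 2 + real i) = fact (Suc (Suc n))"
    by (induction n) (auto simp: algebra_simps)
  moreover have choose: "real (n choose 2) = real n * (real n - 1) / 2"
  proof -
    have "2 dvd n * (n - 1)" by (cases n) auto
    then show ?thesis by (cases n) (auto simp: choose_two real_of_nat_div algebra_simps)
  qed
  ultimately show ?thesis unfolding jacobi_weight_def choose by (simp add: add.commute)
qed

text \<open>
  There are \<open>n\<close> equations for the \<open>n - 1\<close> unknowns that remain when the first and last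
  component of \<open>a\<close> are given; the special value of the first component makes one of them follow from the
  others. Weighting the sums \<open>R r\<close> by \<open>jacobi_weight\<close> eliminates \<open>\<alpha> 1, \<alpha> 2, \<dots>\<close> and leaves a relation
  between \<open>R 1\<close>, \<open>R 2\<close> and \<open>\<alpha> 0\<close>.
\<close>

lemma first_row_from_others:
  fixes \<alpha> :: "nat \<Rightarrow> real"
  assumes n: "n \<ge> 2" and \<alpha>0: "\<alpha> 0 = a_first n"
  defines "R \<equiv> \<lambda>r. \<Sum>k<n. \<alpha> k / (real (r + k) * real (r + k + 1))"
  assumes R2: "R 2 = \<kappa> - 1 / 2" and R3: "\<And>r. 3 \<le> r \<Longrightarrow> r \<le> n \<Longrightarrow> R r = 0"
  shows "R 1 = \<alpha> 0 / 2 - \<kappa> * (\<alpha> 0 + 1)"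
proof -
  have "(\<Sum>r = 1..n. jacobi_weight n r * R r)
      = (\<Sum>k<n. \<alpha> k * (\<Sum>r = 1..n. jacobi_weight n r / (real (r + k) * real (r + k + 1))))"
    unfolding R_def sum_distrib_left by (subst sum.swap) (simp add: mult_ac)
  also have "\<dots> = (\<Sum>k<n. if k = 0 then - fact n * \<alpha> 0 else 0)"
    by (intro sum.cong refl) (simp only: sum_jacobi_weight lessThan_iff, simp)
  also have "\<dots> = - fact n * \<alpha> 0" using n by simp
  finally have "(\<Sum>r = 1..n. jacobi_weight n r * R r) = - fact n * \<alpha> 0" .
  moreover have "{1..n} = insert 1 (insert 2 {3..n})" using n by auto
  moreover have "(\<Sum>r = 3..n. jacobi_weight n r * R r) = 0" using R3 by simp
  ultimately have "jacobi_weight n 1 * R 1 + jacobi_weight n 2 * R 2 = - fact n * \<alpha> 0" by simp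
  then have "fact n * (real n * (real n + 1) * R 1) =
      fact n * (real n * (real n - 1) / 2 * (real n + 1) * (real n + 2) * R 2 + \<alpha> 0)"
    unfolding jacobi_weight_1 jacobi_weight_2 by (simp add: algebra_simps)
  then have "real n * (real n + 1) * R 1
      = real n * (real n - 1) / 2 * (real n + 1) * (real n + 2) * R 2 + \<alpha> 0" by simp
  also have "\<dots> = real n * (real n + 1) * (\<alpha> 0 / 2 - \<kappa> * (\<alpha> 0 + 1))"
    unfolding R2 \<alpha>0 a_first_def by (simp add: field_simps)
  finally show ?thesis using n by simp
qed

section \<open>The linear system for the feedback coefficients\<close>

text \<open>
  Entries of \<open>C\<close> without the common factor \<open>(2n - 1) 2n c\<close>, with indices from 0.
\<close>

definition C_core :: "real \<Rightarrow> nat \<Rightarrow> nat \<Rightarrow> real" where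
  "C_core \<kappa> i j = (if i = 0 \<and> j = 0 then \<kappa> else 1 / (real (i + j + 1) * real (i + j + 2)))"

definition D_coeff :: "nat \<Rightarrow> real" where
  "D_coeff i = (-1) ^ i / fact i"

text \<open>
  The first column is minus a unit vector, so the determinant is up to sign that of the block with
  entries \<open>1 / ((i + j) (i + j + 1))\<close>, \<open>2 \<le> i, j \<le> n - 1\<close>, which is positive definite.
\<close>

lemma det_P_tilde_nonzero: "det (P_tilde n) \<noteq> 0"
proof
  define m where "m = n - 1"
  assume "det (P_tilde n) = 0"
  moreover have P: "P_tilde n \<in> carrier_mat m m" by (simp add: P_tilde_def mat1_def m_def)
  ultimately obtain v where v: "v \<in> carrier_vec m" "v \<noteq> 0\<^sub>v m" "P_tilde n *\<^sub>v v = 0\<^sub>v m"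
    using det_0_iff_vec_prod_zero_field by blast
  then obtain i0 where "i0 < m" "v $ i0 \<noteq> 0" by (metis carrier_vecD eq_vecI index_zero_vec)
  then obtain l where l: "m = Suc l" by (cases m) auto
  define w where "w j = v $ Suc j" for j
  have row: "(\<Sum>j<m. P_tilde n $$ (i, j) * v $ j) = 0" if "i < m" for i
  proof -
    have "(P_tilde n *\<^sub>v v) $ i = 0" using v(3) that by simp
    then show ?thesis using P v(1) that
      by (simp add: scalar_prod_def atLeast0LessThan)
  qed
  have entry: "P_tilde n $$ (i, j) = (if j = 0 then (if i = 0 then - 1 else 0)
      else 1 / (real (i + j + 2) * real (i + j + 3)))" if "i < m" "j < m" for i j
    using that by (simp add: P_tilde_def mat1_def m_def algebra_simps)
  have tail: "(\<Sum>j<l. 1 / real (i + j + 5) / real (i + j + 4) * w j) = 0" if "i < l" for i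
  proof -
    have "(\<Sum>j<m. P_tilde n $$ (Suc i, j) * v $ j)
        = (\<Sum>j<l. P_tilde n $$ (Suc i, Suc j) * v $ Suc j)"
      using that unfolding l by (subst sum.lessThan_Suc_shift) (simp add: entry l)
    also have "\<dots> = (\<Sum>j<l. 1 / real (i + j + 5) / real (i + j + 4) * w j)"
      using that by (intro sum.cong refl) (simp add: entry l w_def algebra_simps)
    finally show ?thesis using row[of "Suc i"] that l by simp
  qed
  have "bform l (\<lambda>i j. 1 / real (i + j + 5) / real (i + j + 4)) w w
      = (\<Sum>i<l. w i * (\<Sum>j<l. 1 / real (i + j + 5) / real (i + j + 4) * w j))"
    by (simp add: bform_def sum_distrib_left mult_ac)
  also have "\<dots> = 0" using tail by simp
  finally have "bform l (\<lambda>i j. 1 / real (i + j + 5) / real (i + j + 4)) w w = 0" .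
  moreover have "pos_def_form l (\<lambda>i j. 1 / real (i + j + 5) / real (i + j + 4))"
    by (intro pos_def_form_divide pos_def_form_Hilbert) auto
  ultimately have w0: "w i = 0" if "i < l" for i
    using pos_def_formD[of l _ i w] that by force
  have "0 = (\<Sum>j<m. P_tilde n $$ (0, j) * v $ j)" using row[of 0] l by simp
  also have "\<dots> = - (v $ 0)"
    using w0 unfolding l by (subst sum.lessThan_Suc_shift) (simp add: entry l w_def)
  finally have "v $ 0 = 0" by simp
  then have "v $ i0 = 0" using w0 \<open>i0 < m\<close> by (cases i0) (auto simp: w_def l)
  then show False using \<open>v $ i0 \<noteq> 0\<close> by simp
qed

lemma Cramer:
  assumes A: "A \<in> carrier_mat m m" and b: "b \<in> carrier_vec m" and "det A \<noteq> (0::real)" and "i < m"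
  shows "(\<Sum>j<m. A $$ (i, j) * (det (replace_col A b j) / det A)) = b $ i"
proof -
  obtain B where B: "B \<in> carrier_mat m m" "A * B = 1\<^sub>m m"
    using det_non_zero_imp_unit[OF A assms(3), of "()"] unfolding Units_def ring_mat_def by auto
  define x where "x = B *\<^sub>v b"
  have x: "x \<in> carrier_vec m" using B b by (simp add: x_def)
  have Ax: "A *\<^sub>v x = b" unfolding x_def using A B b by (simp flip: assoc_mult_mat_vec)
  have "det (replace_col A b j) / det A = x $ j" if "j < m" for j
    using cramer_lemma_mat[OF A x that] assms(3) by (simp add: Ax)
  then have "(\<Sum>j<m. A $$ (i, j) * (det (replace_col A b j) / det A)) = (\<Sum>j<m. A $$ (i, j) * x $ j)"
    by simp
  also have "\<dots> = (A *\<^sub>v x) $ i"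
    using A x \<open>i < m\<close> by (simp add: scalar_prod_def atLeast0LessThan)
  finally show ?thesis by (simp add: Ax)
qed

text \<open>
  With \<open>\<alpha> = D\<^sub>n a\<close> this is the linear system that makes \<open>(A\<^sub>0 + b\<^sub>0 a\<^sup>* + diag(1, \<dots>, n)) F\<^sup>-\<^sup>1\<close> skew
  in its first row and column. Rows \<open>2, \<dots>, n\<close> are the system with matrix \<open>P_tilde n\<close> for the unknowns
  \<open>(\<kappa>, \<alpha>\<^sub>2, \<dots>, \<alpha>\<^bsub>n-1\<^esub>)\<close>, solved by Cramer's rule, which is how \<open>kappa\<close> and \<open>a_vec\<close> arise.
\<close>

lemma a_vec_system:
  fixes an :: real
  assumes n: "n \<ge> 2" and i: "i < n"
  defines "\<kappa> \<equiv> kappa n an"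
  shows "(\<Sum>j<n. C_core \<kappa> i j * (D_coeff j * a_vec n an $ j))
    = (if i = 0 then - \<kappa> else if i = 1 then \<kappa> - 1 / 2 else 0)"
proof -
  define \<alpha> where "\<alpha> j = D_coeff j * a_vec n an $ j" for j
  obtain l where l: "n = Suc (Suc l)" using n by (metis add_2_eq_Suc le_Suc_ex)
  \<comment> \<open>The last coordinate of \<open>D\<^sub>n a\<close> is the free parameter; \<open>z\<close> is the solution by Cramer's rule.\<close>
  define s where "s = (-1) ^ (n - 1) / fact (n - 1) * an"
  define z where "z j = Delta' n (Suc j) / Delta n * s + Delta'' n (Suc j) / Delta n" for j
  have P: "P_tilde n \<in> carrier_mat (Suc l) (Suc l)" by (simp add: P_tilde_def mat1_def l)
  have d: "d' n \<in> carrier_vec (Suc l)" "d'' n \<in> carrier_vec (Suc l)"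
    by (simp_all add: d'_def d''_def vec1_def l)
  have sys: "(\<Sum>j<Suc l. P_tilde n $$ (i, j) * z j) = s * d' n $ i + d'' n $ i" if "i < Suc l" for i
  proof -
    have "(\<Sum>j<Suc l. P_tilde n $$ (i, j) * z j)
      = s * (\<Sum>j<Suc l. P_tilde n $$ (i, j) * (det (replace_col (P_tilde n) (d' n) j) / det (P_tilde n)))
        + (\<Sum>j<Suc l. P_tilde n $$ (i, j) * (det (replace_col (P_tilde n) (d'' n) j) / det (P_tilde n)))"
      unfolding sum_distrib_left sum.distrib[symmetric]
      by (intro sum.cong refl)
        (simp add: z_def Delta_def Delta'_def Delta''_def distrib_left mult_ac)
    then show ?thesis
      using Cramer[OF P d(1) det_P_tilde_nonzero that] Cramer[OF P d(2) det_P_tilde_nonzero that]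
      by simp
  qed
  have \<kappa>: "\<kappa> = z 0" by (simp add: \<kappa>_def kappa_def z_def s_def add_divide_distrib mult_ac)
  have \<alpha>0: "\<alpha> 0 = a_first n" using n by (simp add: \<alpha>_def D_coeff_def a_vec_def vec1_def)
  have sign: "(-1) ^ j * (-1) ^ j = (1::real)" for j :: nat
    by (simp flip: power_mult_distrib)
  have \<alpha>_last: "\<alpha> (Suc l) = s" by (simp add: \<alpha>_def D_coeff_def a_vec_def vec1_def l s_def)
  have \<alpha>_mid: "\<alpha> (Suc j) = z (Suc j)" if "j < l" for j
  proof -
    define X where "X = 1 / Delta n * (Delta' n (Suc (Suc j)) * s + Delta'' n (Suc (Suc j)))"
    have "a_vec n an $ Suc j = - ((-1) ^ j * fact (Suc j) * X)"
      using that unfolding s_def X_def by (simp add: a_vec_def vec1_def l)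
    then have "\<alpha> (Suc j) = ((-1) ^ j * (-1) ^ j) * X"
      by (simp add: \<alpha>_def D_coeff_def del: fact_Suc)
    then show ?thesis by (simp only: sign) (simp add: X_def z_def add_divide_distrib)
  qed
  define R where "R r = (\<Sum>k<n. \<alpha> k / (real (r + k) * real (r + k + 1)))" for r
  \<comment> \<open>Row \<open>i\<close> of the Cramer system is row \<open>i + 1\<close> of the system to be proved.\<close>
  have R: "R (i + 2) = (if i = 0 then \<kappa> - 1 / 2 else 0)" if i: "i < Suc l" for i
  proof -
    define T where "T k = \<alpha> k / (real (i + 2 + k) * real (i + 2 + k + 1))" for k
    define U where "U k = z (Suc k) / (real (i + k + 3) * real (i + k + 4))" for k
    have TU: "T (Suc k) = U k" if "k < l" for k
    proof -
      have e: "i + 2 + Suc k = i + k + 3" "i + k + 3 + 1 = i + k + 4" by simp_all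
      show ?thesis unfolding T_def U_def e \<alpha>_mid[OF that] ..
    qed
    have "R (i + 2) = (\<Sum>k<Suc (Suc l). T k)" by (simp only: R_def T_def l)
    also have "\<dots> = T 0 + (\<Sum>k<l. T (Suc k)) + T (Suc l)"
      by (subst sum.lessThan_Suc, subst sum.lessThan_Suc_shift) (rule refl)
    also have "(\<Sum>k<l. T (Suc k)) = (\<Sum>k<l. U k)" using TU by simp
    also have "T 0 = a_first n / (real (i + 2) * real (i + 3))"
      by (simp add: T_def \<alpha>0 add_ac)
    also have "T (Suc l) = s / (real (i + n + 1) * real (i + n + 2))"
      by (simp add: T_def \<alpha>_last l add_ac)
    finally have "R (i + 2) = a_first n / (real (i + 2) * real (i + 3)) + (\<Sum>k<l. U k)
        + s / (real (i + n + 1) * real (i + n + 2))" .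
    moreover have "(\<Sum>j<Suc l. P_tilde n $$ (i, j) * z j)
        = P_tilde n $$ (i, 0) * z 0 + (\<Sum>k<l. P_tilde n $$ (i, Suc k) * z (Suc k))"
      by (rule sum.lessThan_Suc_shift)
    moreover have "P_tilde n $$ (i, 0) * z 0 = (if i = 0 then - \<kappa> else 0)"
      using i by (simp add: P_tilde_def mat1_def l \<kappa>)
    moreover have "(\<Sum>k<l. P_tilde n $$ (i, Suc k) * z (Suc k)) = (\<Sum>k<l. U k)"
      using i by (intro sum.cong refl) (simp add: P_tilde_def mat1_def l U_def add_ac)
    moreover have "d' n $ i = - (1 / (real (i + n + 1) * real (i + n + 2)))"
      using i by (simp add: d'_def vec1_def l add_ac)
    moreover have "d'' n $ i = - (a_first n / (real (i + 2) * real (i + 3))) - (if i = 0 then 1 / 2 else 0)"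
      using i by (auto simp: d''_def vec1_def l add_ac add_divide_distrib)
    ultimately show ?thesis using sys[OF i] by (auto split: if_splits)
  qed
  have R1: "R 1 = \<alpha> 0 / 2 - \<kappa> * (\<alpha> 0 + 1)"
    unfolding R_def
  proof (rule first_row_from_others[where \<alpha> = \<alpha>, OF n \<alpha>0])
    show "(\<Sum>k<n. \<alpha> k / (real (2 + k) * real (2 + k + 1))) = \<kappa> - 1 / 2"
      using R[of 0] by (simp add: R_def)
    show "(\<Sum>k<n. \<alpha> k / (real (r + k) * real (r + k + 1))) = 0" if "3 \<le> r" "r \<le> n" for r
      using R[of "r - 2"] that l by (simp add: R_def)
  qed
  show ?thesis
  proof (cases i)
    case 0
    have "(\<Sum>j<n. C_core \<kappa> 0 j * \<alpha> j) = \<kappa> * \<alpha> 0 + (R 1 - \<alpha> 0 / 2)"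
      unfolding R_def l by (simp only: sum.lessThan_Suc_shift) (simp add: C_core_def algebra_simps)
    then show ?thesis using 0 R1 by (simp add: \<alpha>_def algebra_simps)
  next
    case (Suc i')
    have "(\<Sum>j<n. C_core \<kappa> i j * \<alpha> j) = R (i' + 2)"
      unfolding R_def using Suc by (intro sum.cong refl) (simp add: C_core_def algebra_simps)
    then show ?thesis using Suc R[of i'] i l by (simp add: \<alpha>_def)
  qed
qed

section \<open>Skew symmetry of the scaled drift\<close>

text \<open>
  For \<open>c\<close> multiplied by \<open>(2n - 1) 2n\<close> these are the entries of \<open>F\<^sup>-\<^sup>1 = D\<^sub>n C D\<^sub>n\<close>.
\<close>

definition G_form :: "real \<Rightarrow> real \<Rightarrow> nat \<Rightarrow> nat \<Rightarrow> real" where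
  "G_form c \<kappa> i j = c * (D_coeff i * C_core \<kappa> i j * D_coeff j)"

lemma C_core_sym: "C_core \<kappa> i j = C_core \<kappa> j i"
  by (simp add: C_core_def add_ac)

lemma G_form_sym: "G_form c \<kappa> i j = G_form c \<kappa> j i"
  by (simp add: G_form_def C_core_sym[of \<kappa> i j] mult_ac)

lemma D_coeff_Suc: "D_coeff i = - (real i + 1) * D_coeff (Suc i)"
proof -
  have "x / f = - r * (- x / (r * f))" if "r \<noteq> 0" for x f r :: real
    using that by simp
  from this[of "real i + 1" "(-1) ^ i" "fact i"] show ?thesis
    unfolding D_coeff_def by simp
qed

lemma D_coeff_nonzero: "D_coeff i \<noteq> 0"
  by (simp add: D_coeff_def)

lemma D_coeff_0: "D_coeff 0 = 1"
  by (simp add: D_coeff_def)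

text \<open>
  Entries of \<open>(A\<^sub>0 + b\<^sub>0 a\<^sup>* + diag(1, \<dots>, n)) g\<close>.
\<close>

definition drift_form :: "nat \<Rightarrow> (nat \<Rightarrow> real) \<Rightarrow> (nat \<Rightarrow> nat \<Rightarrow> real) \<Rightarrow> nat \<Rightarrow> nat \<Rightarrow> real" where
  "drift_form n a g i j =
     (if i = 0 then \<Sum>k<n. a k * g k j else g (i - 1) j) + (real i + 1) * g i j"

text \<open>
  Inside the matrix this is the identity \<open>(i + j + 2) C\<^sub>i\<^sub>j = i C\<^bsub>i-1,j\<^esub> + j C\<^bsub>i,j-1\<^esub>\<close>:
  the diagonal factors \<open>D\<^sub>n\<close> turn the shift \<open>A\<^sub>0\<close> into multiplication by \<open>- i\<close>. In the first row and column the feedback \<open>a\<close> restores the balance.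
\<close>

lemma drift_form_antisym:
  fixes c an :: real
  assumes n: "n \<ge> 2" and ij: "i < n" "j < n"
  defines "S \<equiv> drift_form n (\<lambda>k. a_vec n an $ k) (G_form c (kappa n an))"
  shows "S i j + S j i = 0"
proof -
  define \<kappa> where "\<kappa> = kappa n an"
  define g where "g = G_form c \<kappa>"
  have row0: "(\<Sum>k<n. a_vec n an $ k * G_form c \<kappa> k j)
      = c * D_coeff j * (if j = 0 then - \<kappa> else if j = 1 then \<kappa> - 1 / 2 else 0)" if "j < n" for j
  proof -
    have "(\<Sum>k<n. a_vec n an $ k * G_form c \<kappa> k j)
        = c * D_coeff j * (\<Sum>k<n. C_core \<kappa> j k * (D_coeff k * a_vec n an $ k))"
      unfolding sum_distrib_left
      by (intro sum.cong refl) (simp add: G_form_def C_core_sym[of \<kappa> j] mult_ac)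
    then show ?thesis using a_vec_system[OF n that, of an] by (simp add: \<kappa>_def)
  qed
  have edge: "S 0 j + S j 0 = 0" if "j < n" for j
  proof (cases j)
    case 0
    then show ?thesis using row0[of 0] n
      by (simp add: S_def drift_form_def flip: \<kappa>_def) (simp add: G_form_def D_coeff_0 C_core_def)
  next
    case (Suc k)
    have "S 0 j = c * D_coeff j * (if j = 1 then \<kappa> - 1 / 2 else 0) + g 0 j"
      using row0[OF that] Suc by (simp add: S_def drift_form_def g_def \<kappa>_def)
    moreover have "S j 0 = g k 0 + (real j + 1) * g j 0"
      using Suc by (simp add: S_def drift_form_def g_def \<kappa>_def)
    moreover have "g 0 j = c * D_coeff j * C_core \<kappa> j 0" "g j 0 = c * D_coeff j * C_core \<kappa> j 0"
      by (simp_all add: g_def G_form_def D_coeff_0 C_core_sym[of \<kappa> 0 j])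
    moreover have "g k 0 = - real j * (c * D_coeff j * C_core \<kappa> k 0)"
      by (simp add: g_def G_form_def D_coeff_0 D_coeff_Suc[of k] Suc)
    ultimately have "S 0 j + S j 0 = c * D_coeff j * ((if j = 1 then \<kappa> - 1 / 2 else 0)
        + (real j + 2) * C_core \<kappa> j 0 - real j * C_core \<kappa> k 0)"
      by (simp only: distrib_left distrib_right right_diff_distrib) simp
    also have "\<dots> = 0" 
    proof (cases k)
      case 0
      then show ?thesis using Suc by (simp add: C_core_def)
    next
      case (Suc k')
      have "(real j + 2) * C_core \<kappa> j 0 = 1 / (real j + 1)" "real j * C_core \<kappa> k 0 = 1 / (real j + 1)"
        using \<open>j = Suc k\<close> Suc by (simp_all add: C_core_def add_ac)
      then show ?thesis using \<open>j = Suc k\<close> Suc by simp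
    qed
    finally show ?thesis .
  qed
  show ?thesis
  proof (cases i)
    case 0
    then show ?thesis using edge ij by simp
  next
    case i: (Suc k)
    show ?thesis
    proof (cases j)
      case 0
      then show ?thesis using edge[OF ij(1)] unfolding 0 by linarith
    next
      case j: (Suc l)
      have "S i j = g k j + (real i + 1) * g i j"
        using i by (simp add: S_def drift_form_def g_def \<kappa>_def)
      moreover have "S j i = g i l + (real j + 1) * g i j"
        using j G_form_sym[of c \<kappa> i]
        by (simp only: S_def drift_form_def g_def \<kappa>_def[symmetric]) simp
      moreover have "g k j = - real i * (c * D_coeff i * D_coeff j * C_core \<kappa> k j)"
        by (simp add: g_def G_form_def D_coeff_Suc[of k] i)
      moreover have "g i l = - real j * (c * D_coeff i * D_coeff j * C_core \<kappa> i l)"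
        by (simp add: g_def G_form_def D_coeff_Suc[of l] j)
      moreover have "g i j = c * D_coeff i * D_coeff j * C_core \<kappa> i j"
        by (simp add: g_def G_form_def)
      ultimately have "S i j + S j i = c * D_coeff i * D_coeff j *
          ((real i + real j + 2) * C_core \<kappa> i j - real i * C_core \<kappa> k j - real j * C_core \<kappa> i l)"
        by (simp only: distrib_left distrib_right right_diff_distrib) simp
      also have "\<dots> = 0"
      proof -
        define t where "t = real k + real l + 2"
        have t: "t > 0" "real i + real j = t" using i j by (auto simp: t_def)
        have core: "C_core \<kappa> i j = 1 / ((t + 1) * (t + 2))" "C_core \<kappa> k j = 1 / (t * (t + 1))"
          "C_core \<kappa> i l = 1 / (t * (t + 1))"
          using i j by (simp_all add: C_core_def t_def algebra_simps)
        have "(real i + real j + 2) * C_core \<kappa> i j - real i * C_core \<kappa> k j - real j * C_core \<kappa> i l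
            = (real i + real j + 2) * (1 / ((t + 1) * (t + 2))) - (real i + real j) * (1 / (t * (t + 1)))"
          unfolding core by (simp only: distrib_right diff_diff_eq)
        also have "\<dots> = 0" using t by simp
        finally show ?thesis by simp
      qed
      finally show ?thesis .
    qed
  qed
qed

section \<open>Positive definiteness above the critical parameter\<close>

lemma bform_change_corner:
  assumes "n > 0"
  shows "bform n (\<lambda>i j. if i = 0 \<and> j = 0 then h else b i j) x y
    = bform n b x y + (h - b 0 0) * x 0 * y 0"
proof -
  obtain m where n: "n = Suc m" using assms by (cases n) auto
  show ?thesis unfolding bform_def n
    by (simp only: sum.lessThan_Suc_shift) (simp add: algebra_simps)
qed

text \<open>
  If \<open>v\<close> is in the kernel for corner entry \<open>h\<close>, then \<open>b v\<close> is a multiple of the first unit vector, so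
  Cauchy-Schwarz against \<open>v\<close> bounds \<open>b(x, x)\<close> below by \<open>(b\<^sub>0\<^sub>0 - h) x\<^sub>0\<^sup>2\<close>, which is exactly what is
  lost when the corner entry is lowered to \<open>h\<close>.
\<close>

lemma pos_def_form_above_singular_corner:
  assumes n: "n > 0"
    and sym: "\<And>i j. i < n \<Longrightarrow> j < n \<Longrightarrow> b i j = b j i" and pd: "pos_def_form n b"
    and v: "k < n" "v k \<noteq> 0"
    and singular: "\<And>i. i < n \<Longrightarrow> (\<Sum>j<n. (if i = 0 \<and> j = 0 then h else b i j) * v j) = 0"
    and \<eta>: "h < \<eta>"
  shows "pos_def_form n (\<lambda>i j. if i = 0 \<and> j = 0 then \<eta> else b i j)"
  unfolding pos_def_form_def
proof (intro allI impI)
  define e where "e = b 0 0 - h"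
  \<comment> \<open>The matrix with the corner lowered by \<open>e\<close> annihilates \<open>v\<close>.\<close>
  have bv: "bform n b x v = e * x 0 * v 0" for x
  proof -
    have "bform n (\<lambda>i j. if i = 0 \<and> j = 0 then h else b i j) x v
        = (\<Sum>i<n. x i * (\<Sum>j<n. (if i = 0 \<and> j = 0 then h else b i j) * v j))"
      unfolding bform_def sum_distrib_left by (simp only: mult_ac)
    also have "\<dots> = 0" using singular by simp
    finally show ?thesis unfolding bform_change_corner[OF n] by (simp add: e_def algebra_simps)
  qed
  have "bform n b v v > 0" by (rule pos_def_formD[where x = v, OF pd v])
  then have ev: "e * (v 0)\<^sup>2 > 0" unfolding bv by (simp add: power2_eq_square mult_ac)
  then have e: "e > 0" "(v 0)\<^sup>2 > 0" by (auto simp: zero_less_mult_iff)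
  fix x :: "nat \<Rightarrow> real" assume x: "\<exists>i<n. x i \<noteq> 0"
  have "(e * x 0 * v 0)\<^sup>2 \<le> bform n b x x * (e * v 0 * v 0)"
    using pos_def_form_Cauchy_Schwarz[of n b x v] sym pd unfolding bv by blast
  then have "(e * (v 0)\<^sup>2) * (e * (x 0)\<^sup>2) \<le> (e * (v 0)\<^sup>2) * bform n b x x"
    by (simp add: power2_eq_square mult_ac)
  then have lower: "e * (x 0)\<^sup>2 \<le> bform n b x x" using ev by (simp only: mult_le_cancel_left_pos)
  have pos: "bform n b x x > 0" using pd x unfolding pos_def_form_def by blast
  have corner: "bform n (\<lambda>i j. if i = 0 \<and> j = 0 then \<eta> else b i j) x x
      = (bform n b x x - e * (x 0)\<^sup>2) + (\<eta> - h) * (x 0)\<^sup>2"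
    unfolding bform_change_corner[OF n] by (simp add: e_def power2_eq_square algebra_simps)
  show "bform n (\<lambda>i j. if i = 0 \<and> j = 0 then \<eta> else b i j) x x > 0"
  proof (cases "x 0 = 0")
    case True
    then show ?thesis using pos unfolding bform_change_corner[OF n] by simp
  next
    case False
    then have "(\<eta> - h) * (x 0)\<^sup>2 > 0" using \<eta> by simp
    then show ?thesis using corner lower by linarith
  qed
qed

lemma pos_def_form_Hilbert_corner:
  assumes n: "n > 0" and det: "det (xi_mat n \<xi>) = 0"
    and \<eta>: "(1 + 1 / real n) * \<xi> + 1 / 2 - 1 / (2 * real n) < \<eta>"
  shows "pos_def_form n (\<lambda>i j. if i = 0 \<and> j = 0 then \<eta> else 1 / real (i + j + 1))"
proof -
  define h where "h = (1 + 1 / real n) * \<xi> + 1 / 2 - 1 / (2 * real n)"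
  have X: "xi_mat n \<xi> \<in> carrier_mat n n" by (simp add: xi_mat_def mat1_def)
  then obtain v where v: "v \<in> carrier_vec n" "v \<noteq> 0\<^sub>v n" "xi_mat n \<xi> *\<^sub>v v = 0\<^sub>v n"
    using det det_0_iff_vec_prod_zero_field by blast
  then obtain k where k: "k < n" "v $ k \<noteq> 0" by (metis carrier_vecD eq_vecI index_zero_vec)
  have "(\<Sum>j<n. (if i = 0 \<and> j = 0 then h else 1 / real (i + j + 1)) * v $ j) = 0" if i: "i < n" for i
  proof -
    have "0 = (xi_mat n \<xi> *\<^sub>v v) $ i" using v(3) i by simp
    also have "\<dots> = (\<Sum>j<n. xi_mat n \<xi> $$ (i, j) * v $ j)"
      using X v(1) i by (simp add: scalar_prod_def atLeast0LessThan)
    also have "\<dots> = (\<Sum>j<n. (if i = 0 \<and> j = 0 then h else 1 / real (i + j + 1)) * v $ j)"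
      using i by (intro sum.cong refl) (simp add: xi_mat_def mat1_def h_def)
    finally show ?thesis by simp
  qed
  then show ?thesis
    using \<eta> by (intro pos_def_form_above_singular_corner[OF n _ pos_def_form_Hilbert k(1), of 1 "\<lambda>j. v $ j" h] k(2))
      (auto simp: h_def add_ac)
qed

lemma C_core_numerator:
  "(real (i + j + 2)) * C_core \<kappa> i j = (if i = 0 \<and> j = 0 then 2 * \<kappa> else 1 / real (i + j + 1))"
  by (simp add: C_core_def)

text \<open>
  Multiplying the entries of \<open>C\<close> by \<open>i + j + 2\<close> gives the Hilbert matrix with corner \<open>2\<kappa>\<close>. This product
  is twice the symmetric part of \<open>diag(1, \<dots>, n) C\<close>, and conversely \<open>C\<close> is obtained from it by the dilation
  integral: the Lyapunov equation for \<open>diag(1, \<dots>, n)\<close>.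
\<close>

lemma pos_def_form_C_core:
  assumes "pos_def_form n (\<lambda>i j. if i = 0 \<and> j = 0 then 2 * \<kappa> else 1 / real (i + j + 1))"
  shows "pos_def_form n (C_core \<kappa>)"
    and "pos_def_form n (\<lambda>i j. (real i + 1) * C_core \<kappa> i j)"
proof -
  have "pos_def_form n (\<lambda>i j. (real (i + j + 2)) * C_core \<kappa> i j / real (i + j + 2))"
    unfolding C_core_numerator by (rule pos_def_form_divide[OF _ assms]) simp
  then show "pos_def_form n (C_core \<kappa>)" by simp
  have "2 * bform n (\<lambda>i j. (real i + 1) * C_core \<kappa> i j) x x
      = bform n (\<lambda>i j. if i = 0 \<and> j = 0 then 2 * \<kappa> else 1 / real (i + j + 1)) x x" for x
  proof -
    have "bform n (\<lambda>i j. (real i + 1) * C_core \<kappa> i j) x x = bform n (\<lambda>i j. (real j + 1) * C_core \<kappa> i j) x x"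
      by (subst bform_swap, rule bform_cong) (simp add: C_core_sym)
    then have "2 * bform n (\<lambda>i j. (real i + 1) * C_core \<kappa> i j) x x
        = bform n (\<lambda>i j. (real i + 1) * C_core \<kappa> i j + (real j + 1) * C_core \<kappa> i j) x x"
      by (simp add: bform_add_coeff)
    also have "\<dots> = bform n (\<lambda>i j. real (i + j + 2) * C_core \<kappa> i j) x x"
      by (rule bform_cong) (simp add: algebra_simps)
    finally have "2 * bform n (\<lambda>i j. (real i + 1) * C_core \<kappa> i j) x x
        = bform n (\<lambda>i j. real (i + j + 2) * C_core \<kappa> i j) x x" .
    then show ?thesis unfolding C_core_numerator .
  qed
  note twice = this
  show "pos_def_form n (\<lambda>i j. (real i + 1) * C_core \<kappa> i j)"
    unfolding pos_def_form_def
  proof (intro allI impI)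
    fix x :: "nat \<Rightarrow> real" assume "\<exists>i<n. x i \<noteq> 0"
    then have "bform n (\<lambda>i j. if i = 0 \<and> j = 0 then 2 * \<kappa> else 1 / real (i + j + 1)) x x > 0"
      using assms unfolding pos_def_form_def by blast
    then show "bform n (\<lambda>i j. (real i + 1) * C_core \<kappa> i j) x x > 0" using twice[of x] by linarith
  qed
qed

lemma pos_def_form_congruence:
  assumes pd: "pos_def_form n b" and c: "c > 0" and d: "\<And>i. i < n \<Longrightarrow> d i \<noteq> 0"
  shows "pos_def_form n (\<lambda>i j. c * (d i * b i j * d j))"
  unfolding pos_def_form_def
proof (intro allI impI)
  fix x :: "nat \<Rightarrow> real" assume "\<exists>i<n. x i \<noteq> 0"
  then have "\<exists>i<n. d i * x i \<noteq> 0" using d by auto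
  then have "bform n b (\<lambda>i. d i * x i) (\<lambda>i. d i * x i) > 0"
    by (rule pd[unfolded pos_def_form_def, THEN spec[of _ "\<lambda>i. d i * x i"], THEN mp])
  moreover have "bform n (\<lambda>i j. c * (d i * b i j * d j)) x x = c * bform n b (\<lambda>i. d i * x i) (\<lambda>i. d i * x i)"
  proof -
    have "bform n (\<lambda>i j. c * (d i * b i j * d j)) x x
        = bform n (\<lambda>i j. c * b i j) (\<lambda>i. d i * x i) (\<lambda>i. d i * x i)"
      by (rule bform_cong) (simp only: mult_ac)
    then show ?thesis unfolding bform_scale_coeff .
  qed
  ultimately show "bform n (\<lambda>i j. c * (d i * b i j * d j)) x x > 0" using c by simp
qed

lemma pos_def_form_G_form:
  assumes "n > 0" "c > 0" "det (xi_mat n \<xi>) = 0"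
    and "(1 + 1 / real n) * \<xi> + 1 / 2 - 1 / (2 * real n) < 2 * \<kappa>"
  shows "pos_def_form n (G_form c \<kappa>)"
    and "pos_def_form n (\<lambda>i j. (real i + 1) * G_form c \<kappa> i j)"
proof -
  note C = pos_def_form_C_core[OF pos_def_form_Hilbert_corner[OF assms(1,3,4)]]
  show "pos_def_form n (G_form c \<kappa>)"
    using pos_def_form_congruence[OF C(1) assms(2), of D_coeff] D_coeff_nonzero
    by (simp add: G_form_def[abs_def])
  have "(\<lambda>i j. (real i + 1) * G_form c \<kappa> i j)
      = (\<lambda>i j. c * (D_coeff i * ((real i + 1) * C_core \<kappa> i j) * D_coeff j))"
    by (intro ext) (simp add: G_form_def mult_ac)
  then show "pos_def_form n (\<lambda>i j. (real i + 1) * G_form c \<kappa> i j)"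
    using pos_def_form_congruence[OF C(2) assms(2), of D_coeff] D_coeff_nonzero by simp
qed

section \<open>Derivatives and linear flows\<close>

lemma has_real_derivative_bform:
  assumes "\<And>i. i < n \<Longrightarrow> ((\<lambda>t. y t i) has_real_derivative y' i) (at t within S)"
  shows "((\<lambda>t. bform n b (y t) (y t)) has_real_derivative bform n b y' (y t) + bform n b (y t) y')
    (at t within S)"
proof -
  have "((\<lambda>t. bform n b (y t) (y t)) has_real_derivative
      (\<Sum>i<n. \<Sum>j<n. b i j * y' i * y t j + b i j * y t i * y' j)) (at t within S)"
    unfolding bform_def
    by (intro DERIV_sum) (auto intro!: derivative_eq_intros assms)
  then show ?thesis by (simp add: bform_def sum.distrib)
qed

lemma constant_on_halfopen:
  fixes g :: "real \<Rightarrow> real"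
  assumes "\<And>t. t \<in> {0..<s} \<Longrightarrow> (g has_real_derivative 0) (at t within {0..<s})"
    and t: "t \<in> {0..<s}"
  shows "g t = g 0"
proof (cases "t = 0")
  case False
  show ?thesis
  proof (rule DERIV_isconst_end[where f = g and a = 0 and b = t])
    show "0 < t" using t False by simp
    have "continuous_on {0..<s} g"
      using assms(1) by (meson DERIV_continuous continuous_on_eq_continuous_within)
    then show "continuous_on {0..t} g" by (rule continuous_on_subset) (use t in auto)
    fix x assume x: "0 < x" "x < t"
    have "(g has_real_derivative 0) (at x within {0<..<s})"
      by (rule has_field_derivative_subset[OF assms(1)]) (use x t in auto)
    then show "(g has_real_derivative 0) (at x)"
      using x t by (simp add: at_within_open[of x "{0<..<s}"])
  qed
qed simp

text \<open>
  The exponential series of \<open>M\<close>, applied to \<open>y0\<close> and written as one power series in \<open>\<tau>\<close> for each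
  coordinate.
\<close>

lemma linear_ODE_solution:
  fixes M :: "nat \<Rightarrow> nat \<Rightarrow> real" and y0 :: "nat \<Rightarrow> real"
  obtains Y :: "real \<Rightarrow> nat \<Rightarrow> real"
  where "\<And>i. Y 0 i = y0 i"
    and "\<And>i \<tau>. i < n \<Longrightarrow> ((\<lambda>\<tau>. Y \<tau> i) has_real_derivative (\<Sum>j<n. M i j * Y \<tau> j)) (at \<tau>)"
proof -
  define c where "c m = ((\<lambda>y i. \<Sum>j<n. M i j * y j) ^^ m) y0" for m
  have c0: "c 0 i = y0 i" for i by (simp add: c_def)
  have cS: "c (Suc m) i = (\<Sum>j<n. M i j * c m j)" for m i by (simp add: c_def)
  define K where "K = (\<Sum>i<n. \<Sum>j<n. \<bar>M i j\<bar>)"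
  define B where "B = (\<Sum>i<n. \<bar>y0 i\<bar>)"
  have K: "(\<Sum>j<n. \<bar>M i j\<bar>) \<le> K" if "i < n" for i
    unfolding K_def using that by (intro member_le_sum) (auto intro: sum_nonneg)
  have K0: "K \<ge> 0" "B \<ge> 0" unfolding K_def B_def by (auto intro!: sum_nonneg)
  have bound: "\<bar>c m i\<bar> \<le> B * K ^ m" if "i < n" for m i
    using that
  proof (induction m arbitrary: i)
    case 0
    then show ?case unfolding c0 B_def by (auto intro: member_le_sum)
  next
    case (Suc m)
    have "\<bar>c (Suc m) i\<bar> \<le> (\<Sum>j<n. \<bar>M i j\<bar> * \<bar>c m j\<bar>)"
      unfolding cS by (rule order_trans[OF sum_abs]) (simp add: abs_mult)
    also have "\<dots> \<le> (\<Sum>j<n. \<bar>M i j\<bar> * (B * K ^ m))"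
      by (intro sum_mono mult_left_mono Suc.IH) auto
    also have "\<dots> = (\<Sum>j<n. \<bar>M i j\<bar>) * (B * K ^ m)" by (simp add: sum_distrib_right)
    also have "\<dots> \<le> K * (B * K ^ m)"
      using K[OF Suc.prems] K0 by (intro mult_right_mono) auto
    finally show ?case by (simp add: mult_ac)
  qed
  have summ: "summable (\<lambda>m. c m i / fact m * \<tau> ^ m)" if "i < n" for i \<tau>
  proof (rule summable_comparison_test)
    have "summable (\<lambda>m. B * (inverse (fact m) * (K * \<bar>\<tau>\<bar>) ^ m))"
      by (intro summable_mult summable_exp)
    then show "summable (\<lambda>m. B * K ^ m * \<bar>\<tau>\<bar> ^ m / fact m)"
      by (simp add: power_mult_distrib divide_inverse mult_ac)
    show "\<exists>N. \<forall>m\<ge>N. norm (c m i / fact m * \<tau> ^ m) \<le> B * K ^ m * \<bar>\<tau>\<bar> ^ m / fact m"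
      using bound[OF that]
      by (auto simp: abs_mult power_abs intro!: divide_right_mono mult_right_mono)
  qed
  define Y where "Y \<tau> i = (\<Sum>m. c m i / fact m * \<tau> ^ m)" for \<tau> i
  show ?thesis
  proof
    show "Y 0 i = y0 i" for i
      unfolding Y_def by (subst powser_zero) (simp add: c0)
    fix i \<tau> assume i: "i < n"
    have "((\<lambda>\<tau>. Y \<tau> i) has_real_derivative (\<Sum>m. diffs (\<lambda>m. c m i / fact m) m * \<tau> ^ m)) (at \<tau>)"
      unfolding Y_def by (rule termdiffs_strong_converges_everywhere) (rule summ[OF i])
    also have "(\<lambda>m. diffs (\<lambda>m. c m i / fact m) m * \<tau> ^ m)
        = (\<lambda>m. \<Sum>j<n. M i j * (c m j / fact m * \<tau> ^ m))"
    proof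
      fix m
      have "diffs (\<lambda>m. c m i / fact m) m = c (Suc m) i / fact m"
        unfolding diffs_def by (simp add: divide_simps)
      then show "diffs (\<lambda>m. c m i / fact m) m * \<tau> ^ m = (\<Sum>j<n. M i j * (c m j / fact m * \<tau> ^ m))"
        by (simp add: cS sum_divide_distrib sum_distrib_left mult_ac)
    qed
    also have "(\<Sum>m. \<Sum>j<n. M i j * (c m j / fact m * \<tau> ^ m)) = (\<Sum>j<n. M i j * Y \<tau> j)"
    proof -
      have "(\<Sum>m. \<Sum>j<n. M i j * (c m j / fact m * \<tau> ^ m))
          = (\<Sum>j<n. \<Sum>m. M i j * (c m j / fact m * \<tau> ^ m))"
        by (intro suminf_sum summable_mult summ) simp
      also have "\<dots> = (\<Sum>j<n. M i j * Y \<tau> j)"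
        unfolding Y_def by (intro sum.cong refl suminf_mult summ) simp
      finally show ?thesis .
    qed
    finally show "((\<lambda>\<tau>. Y \<tau> i) has_real_derivative (\<Sum>j<n. M i j * Y \<tau> j)) (at \<tau>)" .
  qed
qed

text \<open>
  The vector field \<open>(A\<^sub>0 + b\<^sub>0 a\<^sup>* + diag(1, \<dots>, n)) y\<close>. It governs \<open>y\<^sub>k = x\<^sub>k / \<Theta>^k\<close> in logarithmic
  time, provided that \<open>\<Theta>\<close> decreases at unit speed.
\<close>

definition scaled_drift :: "nat \<Rightarrow> (nat \<Rightarrow> real) \<Rightarrow> (nat \<Rightarrow> real) \<Rightarrow> nat \<Rightarrow> real" where
  "scaled_drift n a y i = (if i = 0 then \<Sum>k<n. a k * y k else y (i - 1)) + (real i + 1) * y i"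

lemma scaled_flow:
  fixes y0 :: "nat \<Rightarrow> real"
  obtains Y :: "real \<Rightarrow> nat \<Rightarrow> real"
  where "\<And>i. Y 0 i = y0 i"
    and "\<And>i \<tau>. i < n \<Longrightarrow> ((\<lambda>\<tau>. Y \<tau> i) has_real_derivative scaled_drift n a (Y \<tau>) i) (at \<tau>)"
proof -
  define M where "M i j = (if i = 0 then a j else if j = i - 1 then 1 else 0)
    + (if j = i then real i + 1 else 0)" for i j
  have M: "(\<Sum>j<n. M i j * y j) = scaled_drift n a y i" if "i < n" for i y
  proof -
    have "(\<Sum>j<n. M i j * y j) = (\<Sum>j<n. (if i = 0 then a j * y j else if j = i - 1 then y j else 0))
        + (\<Sum>j<n. if j = i then (real i + 1) * y j else 0)"
      unfolding sum.distrib[symmetric] by (intro sum.cong refl) (auto simp: M_def algebra_simps)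
    then show ?thesis using that by (auto simp: scaled_drift_def)
  qed
  obtain Y where Y: "\<And>i. Y 0 i = y0 i"
    "\<And>i \<tau>. i < n \<Longrightarrow> ((\<lambda>\<tau>. Y \<tau> i) has_real_derivative (\<Sum>j<n. M i j * Y \<tau> j)) (at \<tau>)"
    using linear_ODE_solution[of y0 n M] by metis
  show ?thesis by (rule that[of Y]) (use Y M in auto)
qed

section \<open>The closed loop of a homogeneous feedback\<close>

text \<open>
  The part of the argument that needs no formula for \<open>F\<close> and \<open>a\<close>. The form \<open>f\<close> is \<open>F\<close>, and \<open>E\<close> is the
  level \<open>2 a\<^sub>0\<close>. The assumption \<open>pos_def_damping\<close> makes the level function monotone in \<open>\<Theta>\<close>, and
  \<open>conserved\<close> says that the scaled drift is tangent to the level sets of \<open>f\<close>.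
\<close>

locale homogeneous_feedback =
  fixes n :: nat and f :: "nat \<Rightarrow> nat \<Rightarrow> real" and a :: "nat \<Rightarrow> real" and E :: real
  assumes E_pos: "E > 0"
    and commute: "\<And>x y. bform n f x y = bform n f y x"
    and pos_def: "pos_def_form n f"
    and pos_def_damping: "pos_def_form n (\<lambda>i j. (real i + 1) * f i j)"
    and conserved: "\<And>y. bform n f (scaled_drift n a y) y = 0"
    and coordinate_bound: "\<And>i. i < n \<Longrightarrow> \<exists>K. \<forall>y. (y i)\<^sup>2 \<le> K * bform n f y y"
begin

text \<open>
  The variable \<open>\<sigma>\<close> stands for \<open>1 / \<Theta>\<close>. Then \<open>level x \<sigma>\<close> is a polynomial in \<open>\<sigma>\<close>, and it makes sense
  at \<open>\<sigma> = 0\<close> too.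
\<close>

definition rescale :: "(nat \<Rightarrow> real) \<Rightarrow> real \<Rightarrow> nat \<Rightarrow> real" where
  "rescale x \<sigma> i = x i * \<sigma> ^ (i + 1)"

definition level :: "(nat \<Rightarrow> real) \<Rightarrow> real \<Rightarrow> real" where
  "level x \<sigma> = bform n f (rescale x \<sigma>) (rescale x \<sigma>)"

abbreviation damping :: "(nat \<Rightarrow> real) \<Rightarrow> real" where
  "damping y \<equiv> bform n (\<lambda>i j. (real i + 1) * f i j) y y"

abbreviation nonzero :: "(nat \<Rightarrow> real) \<Rightarrow> bool" where
  "nonzero x \<equiv> \<exists>i<n. x i \<noteq> 0"

lemma damping_pos: "nonzero y \<Longrightarrow> damping y > 0"
  using pos_def_damping unfolding pos_def_form_def by blast

lemma damping_eq: "bform n f (\<lambda>i. (real i + 1) * y i) y = damping y"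
  by (rule bform_cong) simp

lemma nonzero_rescale: "\<sigma> > 0 \<Longrightarrow> nonzero x \<Longrightarrow> nonzero (rescale x \<sigma>)"
  by (auto simp: rescale_def)

lemma level_has_derivative:
  assumes "\<sigma> > 0"
  shows "(level x has_real_derivative 2 / \<sigma> * damping (rescale x \<sigma>)) (at \<sigma>)"
proof -
  have "((\<lambda>\<sigma>. rescale x \<sigma> i) has_real_derivative 1 / \<sigma> * ((real i + 1) * rescale x \<sigma> i)) (at \<sigma>)" for i
    unfolding rescale_def by (rule derivative_eq_intros refl)+ (use assms in \<open>simp add: field_simps\<close>)
  from has_real_derivative_bform[where n = n and y = "rescale x" and b = f, OF this]
  have "(level x has_real_derivative 2 * bform n f (\<lambda>i. 1 / \<sigma> * ((real i + 1) * rescale x \<sigma> i)) (rescale x \<sigma>)) (at \<sigma>)"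
    unfolding level_def[abs_def] by (simp add: commute[of "rescale x \<sigma>"])
  then show ?thesis unfolding bform_scale_left damping_eq by simp
qed

lemma level_strict_mono:
  assumes "nonzero x" "0 < \<sigma>" "\<sigma> < \<tau>"
  shows "level x \<sigma> < level x \<tau>"
proof (rule DERIV_pos_imp_increasing[OF assms(3)])
  fix r assume "\<sigma> \<le> r" "r \<le> \<tau>"
  then have r: "r > 0" using assms by simp
  then show "\<exists>y. (level x has_real_derivative y) (at r) \<and> 0 < y"
    using level_has_derivative[OF r, of x] damping_pos[OF nonzero_rescale[OF r assms(1)]]
    by (intro exI[of _ "2 / r * damping (rescale x r)"]) simp
qed

lemma level_less_iff:
  assumes "nonzero x" "0 < \<sigma>" "0 < \<tau>"
  shows "level x \<sigma> < level x \<tau> \<longleftrightarrow> \<sigma> < \<tau>"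
  using level_strict_mono[OF assms(1)] assms(2,3) by (metis less_asym less_linear)

lemma level_0: "level x 0 = 0"
  unfolding level_def by (rule bform_zero) (simp add: rescale_def)

text \<open>
  The level is 0 at \<open>\<sigma> = 0\<close>, it increases, and it is unbounded because \<open>f\<close> controls each
  coordinate.
\<close>

lemma ex1_level:
  assumes x: "nonzero x"
  shows "\<exists>!\<sigma>. \<sigma> > 0 \<and> level x \<sigma> = E"
proof (rule ex_ex1I)
  obtain i where i: "i < n" "x i \<noteq> 0" using x by blast
  obtain K where K: "\<And>y. (y i)\<^sup>2 \<le> K * bform n f y y" using coordinate_bound[OF i(1)] by blast
  define \<sigma> where "\<sigma> = max 1 (K * E / (x i)\<^sup>2)"
  have \<sigma>: "\<sigma> \<ge> 1" "K * E \<le> (x i)\<^sup>2 * \<sigma>"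
    using i by (auto simp: \<sigma>_def max_def field_simps)
  \<comment> \<open>A nonpositive \<open>K\<close> would force \<open>x\<^sub>i = 0\<close>.\<close>
  have K_pos: "K > 0"
  proof (rule ccontr)
    assume "\<not> K > 0"
    then have "K * bform n f x x \<le> 0"
      using pos_def_form_nonneg[OF pos_def, of x] by (simp add: mult_nonpos_nonneg)
    then show False using K[of x] i by (metis less_le_trans not_less zero_less_power2)
  qed
  \<comment> \<open>As \<open>\<sigma> \<ge> 1\<close>, its powers are at least \<open>\<sigma>\<close>, whatever the coordinate \<open>i\<close>.\<close>
  have "\<sigma> \<le> (\<sigma> ^ (i + 1))\<^sup>2"
    using power_increasing[of 1 "(i + 1) * 2" \<sigma>] \<sigma> by (simp only: power_mult) simp
  then have "(x i)\<^sup>2 * \<sigma> \<le> (x i)\<^sup>2 * (\<sigma> ^ (i + 1))\<^sup>2" by (intro mult_left_mono) auto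
  also have "\<dots> = (rescale x \<sigma> i)\<^sup>2" by (simp only: rescale_def power_mult_distrib)
  also have "\<dots> \<le> K * level x \<sigma>" unfolding level_def by (rule K)
  finally have "K * E \<le> K * level x \<sigma>" using \<sigma>(2) by linarith
  then have "E \<le> level x \<sigma>" using K_pos by simp
  moreover have "continuous_on {0..\<sigma>} (level x)"
    unfolding level_def[abs_def] bform_def rescale_def by (intro continuous_intros)
  ultimately obtain r where r: "0 \<le> r" "level x r = E"
    using IVT'[of "level x" 0 E \<sigma>] \<sigma>(1) E_pos level_0[of x] by auto
  moreover have "r \<noteq> 0" using r E_pos level_0[of x] by auto
  ultimately show "\<exists>\<sigma>. \<sigma> > 0 \<and> level x \<sigma> = E" by (intro exI[of _ r]) auto
next
  fix \<sigma> \<tau> assume "\<sigma> > 0 \<and> level x \<sigma> = E" "\<tau> > 0 \<and> level x \<tau> = E"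
  then show "\<sigma> = \<tau>" using level_less_iff[OF x] by (metis less_irrefl less_linear)
qed

definition rate :: "(nat \<Rightarrow> real) \<Rightarrow> real" where
  "rate x = (THE \<sigma>. \<sigma> > 0 \<and> level x \<sigma> = E)"

lemma rate_pos: "nonzero x \<Longrightarrow> rate x > 0"
  and level_rate: "nonzero x \<Longrightarrow> level x (rate x) = E"
  using theI'[OF ex1_level] unfolding rate_def by blast+

lemma rate_eqI: "nonzero x \<Longrightarrow> \<sigma> > 0 \<Longrightarrow> level x \<sigma> = E \<Longrightarrow> rate x = \<sigma>"
  using ex1_level rate_pos level_rate by blast

definition solution :: "real \<Rightarrow> (real \<Rightarrow> nat \<Rightarrow> real) \<Rightarrow> bool" where
  "solution s x \<longleftrightarrow> (\<forall>t\<in>{0..<s}. nonzero (x t) \<and>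
     (\<forall>i<n. ((\<lambda>\<tau>. x \<tau> i) has_real_derivative
        (if i = 0 then \<Sum>k<n. a k * rescale (x t) (rate (x t)) k else x t (i - 1)))
        (at t within {0..<s})))"

lemma solution_restrict:
  assumes "solution T x" "s \<le> T"
  shows "solution s x"
proof -
  have "{0..<s} \<subseteq> {0..<T}" using assms(2) by auto
  then show ?thesis
    using assms(1) unfolding solution_def by (meson has_field_derivative_subset subsetD)
qed

lemma rate_tendsto:
  assumes x: "\<And>t. t \<in> S \<Longrightarrow> nonzero (x t)" and t0: "t\<^sub>0 \<in> S"
    and cont: "\<And>i. i < n \<Longrightarrow> ((\<lambda>t. x t i) \<longlongrightarrow> x t\<^sub>0 i) (at t\<^sub>0 within S)"
  shows "((\<lambda>t. rate (x t)) \<longlongrightarrow> rate (x t\<^sub>0)) (at t\<^sub>0 within S)"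
proof (rule order_tendstoI)
  have lev: "((\<lambda>t. level (x t) \<sigma>) \<longlongrightarrow> level (x t\<^sub>0) \<sigma>) (at t\<^sub>0 within S)" for \<sigma>
    unfolding level_def bform_def rescale_def
    by (intro tendsto_sum tendsto_mult tendsto_const cont) auto
  have in_S: "eventually (\<lambda>t. t \<in> S) (at t\<^sub>0 within S)"
    by (simp add: eventually_at_filter)
  {
    fix l assume l: "l < rate (x t\<^sub>0)"
    define m where "m = max l (rate (x t\<^sub>0) / 2)"
    have m: "0 < m" "l \<le> m" "m < rate (x t\<^sub>0)"
      using l rate_pos[OF x[OF t0]] by (auto simp: m_def)
    have "level (x t\<^sub>0) m < E"
      using level_strict_mono[OF x[OF t0] m(1,3)] level_rate[OF x[OF t0]] by simp
    from order_tendstoD(2)[OF lev this] in_S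
    show "eventually (\<lambda>t. l < rate (x t)) (at t\<^sub>0 within S)"
    proof eventually_elim
      case (elim t)
      then have "level (x t) m < level (x t) (rate (x t))" using level_rate[OF x] by simp
      then show ?case
        using level_less_iff[OF x[OF elim(2)] m(1) rate_pos[OF x[OF elim(2)]]] m by simp
    qed
  next
    fix m assume m: "rate (x t\<^sub>0) < m"
    then have m0: "0 < m" using rate_pos[OF x[OF t0]] by simp
    have "E < level (x t\<^sub>0) m"
      using level_strict_mono[OF x[OF t0] rate_pos[OF x[OF t0]] m] level_rate[OF x[OF t0]] by simp
    from order_tendstoD(1)[OF lev this] in_S
    show "eventually (\<lambda>t. rate (x t) < m) (at t\<^sub>0 within S)"
    proof eventually_elim
      case (elim t)
      then have "level (x t) (rate (x t)) < level (x t) m" using level_rate[OF x] by simp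
      then show ?case
        using level_less_iff[OF x[OF elim(2)] rate_pos[OF x[OF elim(2)]] m0] by simp
    qed
  }
qed

text \<open>
  The difference quotient of \<open>level x\<close> as a polynomial in both arguments. Unlike a mean value point,
  it depends continuously on \<open>x\<close>, \<open>\<sigma>\<close> and \<open>\<tau>\<close> together.
\<close>

definition level_slope :: "(nat \<Rightarrow> real) \<Rightarrow> real \<Rightarrow> real \<Rightarrow> real" where
  "level_slope x \<sigma> \<tau> = (\<Sum>i<n. \<Sum>j<n. f i j * x i * x j * (\<Sum>p<Suc (i + j + 1). \<sigma> ^ p * \<tau> ^ (i + j + 1 - p)))"

lemma level_diff: "level x \<sigma> - level x \<tau> = (\<sigma> - \<tau>) * level_slope x \<sigma> \<tau>"
proof -
  have lev: "level x \<sigma> = (\<Sum>i<n. \<Sum>j<n. f i j * x i * x j * \<sigma> ^ Suc (i + j + 1))" for \<sigma>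
    unfolding level_def bform_def rescale_def
    by (intro sum.cong refl) (simp add: power_add mult_ac)
  show ?thesis
    unfolding lev level_slope_def sum_distrib_left sum_subtractf[symmetric] right_diff_distrib[symmetric]
      diff_power_eq_sum
    by (simp only: mult_ac)
qed

lemma level_slope_diag:
  assumes "\<sigma> > 0"
  shows "level_slope x \<sigma> \<sigma> = 2 / \<sigma> * damping (rescale x \<sigma>)"
proof (rule tendsto_unique)
  show "at \<sigma> \<noteq> bot" by simp
  have "continuous_on UNIV (\<lambda>\<tau>. level_slope x \<tau> \<sigma>)"
    unfolding level_slope_def by (intro continuous_intros)
  then show "((\<lambda>\<tau>. level_slope x \<tau> \<sigma>) \<longlongrightarrow> level_slope x \<sigma> \<sigma>) (at \<sigma>)"
    by (simp add: continuous_on_def)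
  have "((\<lambda>\<tau>. (level x \<tau> - level x \<sigma>) / (\<tau> - \<sigma>)) \<longlongrightarrow> 2 / \<sigma> * damping (rescale x \<sigma>)) (at \<sigma>)"
    using level_has_derivative[OF assms] by (simp add: has_field_derivative_iff)
  then show "((\<lambda>\<tau>. level_slope x \<tau> \<sigma>) \<longlongrightarrow> 2 / \<sigma> * damping (rescale x \<sigma>)) (at \<sigma>)"
    by (rule Lim_transform_eventually) (auto simp: eventually_at_filter level_diff)
qed

text \<open>
  Implicit differentiation of \<open>level (x t) (rate (x t)) = E\<close>. At fixed \<open>\<sigma>\<close> the motion of \<open>x\<close> is the
  scaled drift minus \<open>diag(1, \<dots>, n) y\<close>; the first conserves the form, so the time derivative is
  \<open>- 2 \<sigma>\<close> times the damping, while the derivative in \<open>\<sigma>\<close> is \<open>2 / \<sigma>\<close> times the same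
  damping. The damping cancels and \<open>\<sigma>' = \<sigma>\<^sup>2\<close> remains, that is \<open>\<Theta>' = - 1\<close>.
\<close>

lemma rate_has_derivative:
  assumes sol: "solution s x" and t0: "t\<^sub>0 \<in> {0..<s}"
  shows "((\<lambda>t. rate (x t)) has_real_derivative (rate (x t\<^sub>0))\<^sup>2) (at t\<^sub>0 within {0..<s})"
proof -
  define S where "S = {0..<s}"
  define \<sigma> where "\<sigma> = rate (x t\<^sub>0)"
  define y where "y = rescale (x t\<^sub>0) \<sigma>"
  have nz: "nonzero (x t)" if "t \<in> S" for t using sol that by (auto simp: solution_def S_def)
  have t0: "t\<^sub>0 \<in> S" using t0 by (simp add: S_def)
  have \<sigma>: "\<sigma> > 0" unfolding \<sigma>_def by (rule rate_pos[OF nz[OF t0]])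
  define x' where "x' i = (if i = 0 then \<Sum>k<n. a k * y k else x t\<^sub>0 (i - 1))" for i
  have der: "((\<lambda>t. x t i) has_real_derivative x' i) (at t\<^sub>0 within S)" if "i < n" for i
    using sol t0 that unfolding solution_def S_def x'_def y_def \<sigma>_def by blast
  have cont: "((\<lambda>t. x t i) \<longlongrightarrow> x t\<^sub>0 i) (at t\<^sub>0 within S)" if "i < n" for i
    using DERIV_continuous[OF der[OF that]] by (simp add: continuous_within)
  have rate_cont: "((\<lambda>t. rate (x t)) \<longlongrightarrow> \<sigma>) (at t\<^sub>0 within S)"
    unfolding \<sigma>_def by (rule rate_tendsto[OF nz t0 cont])
  have slope: "((\<lambda>t. level_slope (x t) (rate (x t)) \<sigma>) \<longlongrightarrow> 2 / \<sigma> * damping y) (at t\<^sub>0 within S)"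
    unfolding y_def level_slope_diag[OF \<sigma>, symmetric] unfolding level_slope_def
    by (intro tendsto_sum tendsto_mult tendsto_power tendsto_const cont rate_cont) auto
  have damp: "damping y > 0"
    unfolding y_def by (rule damping_pos[OF nonzero_rescale[OF \<sigma> nz[OF t0]]])
  have x'_scaled: "x' i * \<sigma> ^ (i + 1) = \<sigma> * (scaled_drift n a y i + (- 1) * ((real i + 1) * y i))" for i
    by (cases i) (simp_all add: x'_def scaled_drift_def y_def rescale_def)
  have "((\<lambda>t. rescale (x t) \<sigma> i) has_real_derivative x' i * \<sigma> ^ (i + 1)) (at t\<^sub>0 within S)"
    if "i < n" for i
    unfolding rescale_def by (rule DERIV_cmult_right[OF der[OF that]])
  from has_real_derivative_bform[where n = n and y = "\<lambda>t. rescale (x t) \<sigma>" and b = f, OF this]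
  have "((\<lambda>t. level (x t) \<sigma>) has_real_derivative 2 * bform n f (\<lambda>i. x' i * \<sigma> ^ (i + 1)) y) (at t\<^sub>0 within S)"
    unfolding level_def y_def[symmetric] commute[of y] by simp
  also have "2 * bform n f (\<lambda>i. x' i * \<sigma> ^ (i + 1)) y = - (2 * \<sigma> * damping y)"
    unfolding x'_scaled bform_scale_left bform_add_left conserved damping_eq by simp
  finally have level_t: "((\<lambda>t. (level (x t) \<sigma> - level (x t\<^sub>0) \<sigma>) / (t - t\<^sub>0)) \<longlongrightarrow> - (2 * \<sigma> * damping y))
      (at t\<^sub>0 within S)"
    by (simp add: has_field_derivative_iff)
  have "((\<lambda>t. - ((level (x t) \<sigma> - level (x t\<^sub>0) \<sigma>) / (t - t\<^sub>0)) / level_slope (x t) (rate (x t)) \<sigma>)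
      \<longlongrightarrow> - (- (2 * \<sigma> * damping y)) / (2 / \<sigma> * damping y)) (at t\<^sub>0 within S)"
    using damp \<sigma> by (intro tendsto_divide tendsto_minus level_t slope) auto
  also have "- (- (2 * \<sigma> * damping y)) / (2 / \<sigma> * damping y) = \<sigma>\<^sup>2"
    using damp \<sigma> by (simp add: field_simps power2_eq_square)
  finally have lim: "((\<lambda>t. - ((level (x t) \<sigma> - level (x t\<^sub>0) \<sigma>) / (t - t\<^sub>0)) / level_slope (x t) (rate (x t)) \<sigma>)
      \<longlongrightarrow> \<sigma>\<^sup>2) (at t\<^sub>0 within S)" .
  have "eventually (\<lambda>t. level_slope (x t) (rate (x t)) \<sigma> > 0) (at t\<^sub>0 within S)"
    using order_tendstoD(1)[OF slope] damp \<sigma> by simp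
  moreover have "eventually (\<lambda>t. t \<in> S) (at t\<^sub>0 within S)" by (simp add: eventually_at_filter)
  ultimately have "eventually (\<lambda>t. - ((level (x t) \<sigma> - level (x t\<^sub>0) \<sigma>) / (t - t\<^sub>0)) / level_slope (x t) (rate (x t)) \<sigma>
      = (rate (x t) - rate (x t\<^sub>0)) / (t - t\<^sub>0)) (at t\<^sub>0 within S)"
  proof eventually_elim
    case (elim t)
    have "- (level (x t) \<sigma> - level (x t\<^sub>0) \<sigma>) = level (x t) (rate (x t)) - level (x t) \<sigma>"
      using level_rate[OF nz[OF elim(2)]] level_rate[OF nz[OF t0]] by (simp add: \<sigma>_def)
    also have "\<dots> = (rate (x t) - \<sigma>) * level_slope (x t) (rate (x t)) \<sigma>" by (rule level_diff)
    finally have eq: "- (level (x t) \<sigma> - level (x t\<^sub>0) \<sigma>)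
        = (rate (x t) - \<sigma>) * level_slope (x t) (rate (x t)) \<sigma>" .
    have "- ((level (x t) \<sigma> - level (x t\<^sub>0) \<sigma>) / (t - t\<^sub>0)) / level_slope (x t) (rate (x t)) \<sigma>
        = - (level (x t) \<sigma> - level (x t\<^sub>0) \<sigma>) / level_slope (x t) (rate (x t)) \<sigma> / (t - t\<^sub>0)"
    proof -
      have "- (x / d) / l = - x / l / d" for x d l :: real by (simp add: mult.commute)
      then show ?thesis .
    qed
    then show ?case unfolding eq using elim(1) by (simp add: \<sigma>_def)
  qed
  from Lim_transform_eventually[OF lim this] show ?thesis
    by (simp add: has_field_derivative_iff S_def \<sigma>_def)
qed

lemma rate_along_solution:
  assumes sol: "solution s x" and t: "t \<in> {0..<s}"
  shows "1 / rate (x t) = 1 / rate (x 0) - t"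
proof -
  have "1 / rate (x t) + t = 1 / rate (x 0) + 0"
  proof (rule constant_on_halfopen[OF _ t, where g = "\<lambda>t. 1 / rate (x t) + t"])
    fix t assume t: "t \<in> {0..<s}"
    then have "rate (x t) > 0" using sol by (intro rate_pos) (auto simp: solution_def)
    then show "((\<lambda>t. 1 / rate (x t) + t) has_real_derivative 0) (at t within {0..<s})"
      by (auto intro!: derivative_eq_intros rate_has_derivative[OF sol t] simp: power2_eq_square)
  qed
  then show ?thesis by simp
qed

lemma solution_time_bound:
  assumes sol: "solution s x" and s: "s > 0"
  shows "s \<le> 1 / rate (x 0)"
proof (rule ccontr)
  assume "\<not> s \<le> 1 / rate (x 0)"
  moreover have r0: "rate (x 0) > 0" using sol s by (intro rate_pos) (auto simp: solution_def)
  ultimately have T: "1 / rate (x 0) \<in> {0..<s}" by simp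
  then have "rate (x (1 / rate (x 0))) > 0" using sol by (intro rate_pos) (auto simp: solution_def)
  then show False using rate_along_solution[OF sol T] by simp
qed

text \<open>
  Once \<open>\<Theta>\<close> is known to be the same function of time for both solutions, the closed loop is a linear
  equation. The rescaled difference \<open>z\<close> of the two solutions follows the scaled drift and conserves
  the form, which is 0 at the start.
\<close>

lemma solution_unique:
  assumes sol: "solution s x" "solution s x'" and init: "\<And>i. i < n \<Longrightarrow> x 0 i = x' 0 i"
    and rate0: "rate (x 0) = rate (x' 0)"
    and t: "t \<in> {0..<s}" and i: "i < n"
  shows "x t i = x' t i"
proof -
  define \<sigma> where "\<sigma> t = rate (x t)" for t
  have \<sigma>': "rate (x' t) = \<sigma> t" if "t \<in> {0..<s}" for t
  proof -
    have "inverse (rate (x' t)) = inverse (rate (x t))"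
      using rate_along_solution[OF sol(1) that] rate_along_solution[OF sol(2) that] rate0
      by (simp add: inverse_eq_divide)
    then show ?thesis by (simp only: inverse_eq_iff_eq \<sigma>_def)
  qed
  have \<sigma>: "\<sigma> t > 0" if "t \<in> {0..<s}" for t
    unfolding \<sigma>_def using sol(1) that by (intro rate_pos) (auto simp: solution_def)
  \<comment> \<open>Here \<open>\<sigma> t\<close> serves as the scale for both solutions.\<close>
  define z where "z t i = (x t i - x' t i) * \<sigma> t ^ (i + 1)" for t i
  have z_der: "((\<lambda>t. z t i) has_real_derivative \<sigma> t * scaled_drift n a (z t) i) (at t within {0..<s})"
    if t: "t \<in> {0..<s}" and i: "i < n" for t i
  proof -
    \<comment> \<open>The difference of the closed-loop equations is linear because the scales agree.\<close>
    define v where "v = (if i = 0 then \<Sum>k<n. a k * z t k else x t (i - 1) - x' t (i - 1))"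
    have diff: "((\<lambda>t. x t i - x' t i) has_real_derivative v) (at t within {0..<s})"
    proof -
      have "((\<lambda>t. x t i - x' t i) has_real_derivative
         ((if i = 0 then \<Sum>k<n. a k * rescale (x t) (rate (x t)) k else x t (i - 1)) -
         (if i = 0 then \<Sum>k<n. a k * rescale (x' t) (rate (x' t)) k else x' t (i - 1)))) (at t within {0..<s})"
        using sol t i unfolding solution_def by (intro DERIV_diff) auto
      also have "(if i = 0 then \<Sum>k<n. a k * rescale (x t) (rate (x t)) k else x t (i - 1)) -
         (if i = 0 then \<Sum>k<n. a k * rescale (x' t) (rate (x' t)) k else x' t (i - 1)) = v"
        unfolding \<sigma>'[OF t] v_def \<sigma>_def[symmetric]
        by (simp add: z_def rescale_def sum_subtractf left_diff_distrib right_diff_distrib)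
      finally show ?thesis .
    qed
    have "(\<sigma> has_real_derivative (\<sigma> t)\<^sup>2) (at t within {0..<s})"
      unfolding \<sigma>_def[abs_def] by (rule rate_has_derivative[OF sol(1) t])
    from DERIV_mult[OF diff DERIV_power[OF this, of "i + 1"]]
    have "((\<lambda>t. z t i) has_real_derivative
       v * \<sigma> t ^ (i + 1) + (x t i - x' t i) * (real (i + 1) * \<sigma> t ^ i * (\<sigma> t)\<^sup>2)) (at t within {0..<s})"
      unfolding z_def by (simp add: mult_ac)
    also have "v * \<sigma> t ^ (i + 1) + (x t i - x' t i) * (real (i + 1) * \<sigma> t ^ i * (\<sigma> t)\<^sup>2)
        = \<sigma> t * scaled_drift n a (z t) i"
      by (cases i) (simp_all add: v_def scaled_drift_def z_def power2_eq_square algebra_simps)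
    finally show ?thesis .
  qed
  have "bform n f (z t) (z t) = bform n f (z 0) (z 0)"
  proof (rule constant_on_halfopen[OF _ t, where g = "\<lambda>t. bform n f (z t) (z t)"])
    fix t assume t: "t \<in> {0..<s}"
    have "((\<lambda>t. bform n f (z t) (z t)) has_real_derivative
        2 * bform n f (\<lambda>i. \<sigma> t * scaled_drift n a (z t) i) (z t)) (at t within {0..<s})"
      using has_real_derivative_bform[where n = n and y = z and b = f, OF z_der[OF t]] by (simp add: commute[of "z t"])
    then show "((\<lambda>t. bform n f (z t) (z t)) has_real_derivative 0) (at t within {0..<s})"
      by (simp add: bform_scale_left conserved)
  qed
  also have "\<dots> = 0" by (rule bform_zero) (simp add: z_def init)
  finally have "z t i = 0" using pos_def_formD[OF pos_def i, of "z t"] by force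
  then show ?thesis using \<sigma>[OF t] by (simp add: z_def)
qed

text \<open>
  The trajectory \<open>x\<^sub>k = (T - t)^k Y\<^sub>k(ln T - ln (T - t))\<close> for a solution \<open>Y\<close> of the scaled flow. The form
  stays equal to \<open>E\<close> along \<open>Y\<close>, hence \<open>T - t\<close> is the value of \<open>\<Theta>\<close> at time \<open>t\<close>, and \<open>Y\<close> stays
  bounded, hence the trajectory tends to the origin.
\<close>

lemma solution_exists:
  assumes x0: "nonzero x\<^sub>0"
  defines "T \<equiv> 1 / rate x\<^sub>0"
  obtains \<phi> where "\<And>i. \<phi> 0 i = x\<^sub>0 i" "solution T \<phi>" "\<And>i. \<phi> T i = 0"
    "\<And>i. i < n \<Longrightarrow> continuous_on {0..T} (\<lambda>t. \<phi> t i)"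
proof -
  define \<sigma> where "\<sigma> = rate x\<^sub>0"
  have T: "T > 0" "1 / T = \<sigma>" "T * \<sigma> = 1" using rate_pos[OF x0] by (auto simp: T_def \<sigma>_def)
  obtain Y where Y0: "\<And>i. Y 0 i = rescale x\<^sub>0 \<sigma> i" and
    Y: "\<And>i \<tau>. i < n \<Longrightarrow> ((\<lambda>\<tau>. Y \<tau> i) has_real_derivative scaled_drift n a (Y \<tau>) i) (at \<tau>)"
    using scaled_flow[of "rescale x\<^sub>0 \<sigma>" n a] by blast
  have QY: "bform n f (Y \<tau>) (Y \<tau>) = E" for \<tau>
  proof -
    have "((\<lambda>\<tau>. bform n f (Y \<tau>) (Y \<tau>)) has_real_derivative 0) (at \<tau>)" for \<tau>
      using has_real_derivative_bform[where n = n and y = Y and b = f and t = \<tau>, OF Y]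
      by (simp add: commute[of "Y \<tau>"] conserved)
    then have "bform n f (Y \<tau>) (Y \<tau>) = bform n f (Y 0) (Y 0)"
      using DERIV_isconst_all[of "\<lambda>\<tau>. bform n f (Y \<tau>) (Y \<tau>)"] by blast
    also have "\<dots> = level x\<^sub>0 \<sigma>" unfolding level_def by (rule bform_cong) (simp add: Y0)
    also have "\<dots> = E" unfolding \<sigma>_def by (rule level_rate[OF x0])
    finally show ?thesis .
  qed
  \<comment> \<open>Logarithmic time, in which \<open>y' = M y / (T - t)\<close> becomes autonomous.\<close>
  define \<tau> where "\<tau> t = ln T - ln (T - t)" for t
  define \<phi> where "\<phi> t i = (T - t) ^ (i + 1) * Y (\<tau> t) i" for t i
  have resc: "rescale (\<phi> t) (1 / (T - t)) = Y (\<tau> t)" if "t < T" for t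
    using that by (intro ext) (simp add: rescale_def \<phi>_def power_divide)
  have nz: "nonzero (\<phi> t)" if "t < T" for t
  proof (rule ccontr)
    assume "\<not> nonzero (\<phi> t)"
    then have "bform n f (Y (\<tau> t)) (Y (\<tau> t)) = 0"
      using that by (intro bform_zero) (auto simp: \<phi>_def)
    then show False using QY E_pos by simp
  qed
  have rate: "rate (\<phi> t) = 1 / (T - t)" if "t < T" for t
    using that by (intro rate_eqI nz) (auto simp: level_def resc QY)
  show ?thesis
  proof
    show "\<phi> 0 i = x\<^sub>0 i" for i
      using T by (simp add: \<phi>_def \<tau>_def Y0 rescale_def flip: power_mult_distrib power_Suc)
    show "\<phi> T i = 0" for i by (simp add: \<phi>_def)
    show sol: "solution T \<phi>"
      unfolding solution_def
    proof (intro ballI conjI allI impI)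
      fix t assume "t \<in> {0..<T}"
      then have t: "t < T" by simp
      show "nonzero (\<phi> t)" by (rule nz[OF t])
      fix i assume i: "i < n"
      have \<tau>': "(\<tau> has_real_derivative 1 / (T - t)) (at t within {0..<T})"
        unfolding \<tau>_def[abs_def] using t by (auto intro!: derivative_eq_intros)
      have flow: "((\<lambda>t. Y (\<tau> t) i) has_real_derivative scaled_drift n a (Y (\<tau> t)) i * (1 / (T - t)))
          (at t within {0..<T})"
        by (rule DERIV_chain2[OF Y[OF i] \<tau>'])
      have lin: "((\<lambda>t. T - t) has_real_derivative - 1) (at t within {0..<T})"
        by (auto intro!: derivative_eq_intros)
      from DERIV_mult[OF DERIV_power[OF lin, of "i + 1"] flow]
      have "((\<lambda>t. \<phi> t i) has_real_derivative
          - (real (i + 1) * (T - t) ^ i) * Y (\<tau> t) i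
          + (T - t) ^ (i + 1) * (scaled_drift n a (Y (\<tau> t)) i * (1 / (T - t)))) (at t within {0..<T})"
        unfolding \<phi>_def by (simp add: mult_ac)
      also have "- (real (i + 1) * (T - t) ^ i) * Y (\<tau> t) i
          + (T - t) ^ (i + 1) * (scaled_drift n a (Y (\<tau> t)) i * (1 / (T - t)))
          = (if i = 0 then \<Sum>k<n. a k * rescale (\<phi> t) (rate (\<phi> t)) k else \<phi> t (i - 1))"
      proof -
        have "- (k * r ^ i) * y + r ^ (i + 1) * (d * (1 / r)) = r ^ i * (d - k * y)"
          if "r \<noteq> 0" for k r y d :: real
          using that by (simp add: right_diff_distrib mult_ac)
        moreover have "scaled_drift n a (Y (\<tau> t)) i - real (i + 1) * Y (\<tau> t) i
            = (if i = 0 then \<Sum>k<n. a k * Y (\<tau> t) k else Y (\<tau> t) (i - 1))"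
          by (simp add: scaled_drift_def)
        ultimately show ?thesis
          unfolding rate[OF t] resc[OF t] using t by (cases i) (simp_all add: \<phi>_def)
      qed
      finally show "((\<lambda>t. \<phi> t i) has_real_derivative
          (if i = 0 then \<Sum>k<n. a k * rescale (\<phi> t) (rate (\<phi> t)) k else \<phi> t (i - 1)))
          (at t within {0..<T})" .
    qed
    fix i assume i: "i < n"
    obtain K where K: "\<And>y. (y i)\<^sup>2 \<le> K * bform n f y y" using coordinate_bound[OF i] by blast
    have bound: "\<bar>\<phi> t i\<bar> \<le> (T - t) ^ (i + 1) * sqrt (K * E)" if "t \<le> T" for t
    proof -
      have "\<bar>Y (\<tau> t) i\<bar> \<le> sqrt (K * E)"
        using K[of "Y (\<tau> t)"] unfolding QY by (rule real_le_rsqrt[of "\<bar>_\<bar>", simplified])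
      then show ?thesis using that unfolding \<phi>_def by (auto simp: abs_mult intro!: mult_left_mono)
    qed
    show "continuous_on {0..T} (\<lambda>t. \<phi> t i)"
      unfolding continuous_on_eq_continuous_within
    proof
      fix t assume t: "t \<in> {0..T}"
      show "continuous (at t within {0..T}) (\<lambda>t. \<phi> t i)"
      proof (cases "t = T")
        case False
        then have "t \<in> {0..<T}" using t by simp
        then have "continuous (at t within {0..<T}) (\<lambda>t. \<phi> t i)"
          using sol i unfolding solution_def by (meson DERIV_continuous)
        moreover have "at t within {0..<T} = at t within {0..T}"
          by (rule at_within_nhd[where S = "{..<T}"]) (use t False in auto)
        ultimately show ?thesis by simp
      next
        case True
        have "((\<lambda>t. \<phi> t i) \<longlongrightarrow> 0) (at T within {0..T})"
        proof (rule tendsto_rabs_zero_cancel, rule tendsto_sandwich)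
          show "eventually (\<lambda>t. 0 \<le> \<bar>\<phi> t i\<bar>) (at T within {0..T})" by simp
          show "eventually (\<lambda>t. \<bar>\<phi> t i\<bar> \<le> (T - t) ^ (i + 1) * sqrt (K * E)) (at T within {0..T})"
            using bound by (auto simp: eventually_at_filter)
          have "((\<lambda>t. (T - t) ^ (i + 1) * sqrt (K * E)) \<longlongrightarrow> (T - T) ^ (i + 1) * sqrt (K * E))
              (at T within {0..T})"
            by (intro tendsto_intros)
          then show "((\<lambda>t. (T - t) ^ (i + 1) * sqrt (K * E)) \<longlongrightarrow> 0) (at T within {0..T})" by simp
          show "((\<lambda>t. 0) \<longlongrightarrow> (0::real)) (at T within {0..T})" by simp
        qed
        then show ?thesis using True by (simp add: continuous_within \<phi>_def)
      qed
    qed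
  qed
qed

end

section \<open>Passing from a form to its inverse\<close>

text \<open>
  All properties required of \<open>f = F\<close> are read off from its inverse \<open>g = D\<^sub>n C D\<^sub>n\<close>, whose entries are
  explicit, by the substitution \<open>p = F y\<close>.
\<close>

locale inverse_forms =
  fixes n :: nat and f g :: "nat \<Rightarrow> nat \<Rightarrow> real"
  assumes inverse: "\<And>i j. i < n \<Longrightarrow> j < n \<Longrightarrow> (\<Sum>k<n. g i k * f k j) = (if i = j then 1 else 0)"
    and sym: "\<And>i j. g i j = g j i"
    and pd: "pos_def_form n g"
begin

definition dual :: "(nat \<Rightarrow> real) \<Rightarrow> nat \<Rightarrow> real" where
  "dual y k = (\<Sum>j<n. f k j * y j)"

lemma primal: "(\<Sum>k<n. g i k * dual y k) = y i" if "i < n"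
proof -
  have "(\<Sum>k<n. g i k * dual y k) = (\<Sum>j<n. (\<Sum>k<n. g i k * f k j) * y j)"
    unfolding dual_def sum_distrib_left sum_distrib_right by (subst sum.swap) (simp only: mult_ac)
  also have "\<dots> = (\<Sum>j<n. if i = j then y j else 0)" using inverse that by (intro sum.cong) auto
  finally show ?thesis using that by simp
qed

lemma bform_dual: "bform n f x y = (\<Sum>i<n. x i * dual y i)"
  unfolding bform_def dual_def sum_distrib_left by (simp only: mult_ac)

lemma bform_dual_map:
  assumes "\<And>i. i < n \<Longrightarrow> x i = (\<Sum>k<n. m i k * dual y k)"
  shows "bform n f x y = bform n m (dual y) (dual y)"
  unfolding bform_dual using assms by (simp add: bform_def sum_distrib_right sum_distrib_left mult_ac)

lemma bform_dual_self: "bform n f y y = bform n g (dual y) (dual y)"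
  by (rule bform_dual_map) (simp add: primal)

lemma bform_f_commute: "bform n f x y = bform n f y x"
proof -
  have "bform n f x y = bform n g (dual y) (dual x)" for x y
  proof -
    have "bform n f x y = (\<Sum>i<n. dual y i * (\<Sum>k<n. g i k * dual x k))"
      unfolding bform_dual by (simp add: primal mult.commute)
    then show ?thesis unfolding bform_def sum_distrib_left by (simp only: mult_ac)
  qed
  then show ?thesis using bform_commute[of n g] sym by metis
qed

lemma dual_nonzero: "\<exists>i<n. y i \<noteq> 0 \<Longrightarrow> \<exists>i<n. dual y i \<noteq> 0"
proof (rule ccontr)
  assume y: "\<exists>i<n. y i \<noteq> 0" and "\<not> (\<exists>i<n. dual y i \<noteq> 0)"
  then have "(\<Sum>k<n. g i k * dual y k) = 0" for i by simp
  then show False using primal[of _ y] y by auto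
qed

lemma pos_def_form_inverse: "pos_def_form n f"
  using pd dual_nonzero unfolding pos_def_form_def bform_dual_self by blast

lemma pos_def_form_inverse_damping:
  assumes "pos_def_form n (\<lambda>i j. (real i + 1) * g i j)"
  shows "pos_def_form n (\<lambda>i j. (real i + 1) * f i j)"
proof -
  have "bform n (\<lambda>i j. (real i + 1) * f i j) y y
      = bform n (\<lambda>i j. (real i + 1) * g i j) (dual y) (dual y)" for y
  proof -
    have "bform n (\<lambda>i j. (real i + 1) * f i j) y y = bform n f (\<lambda>i. (real i + 1) * y i) y"
      by (rule bform_cong) simp
    also have "\<dots> = bform n (\<lambda>i j. (real i + 1) * g i j) (dual y) (dual y)"
      by (rule bform_dual_map) (simp only: mult.assoc sum_distrib_left[symmetric] primal)
    finally show ?thesis .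
  qed
  then show ?thesis using assms dual_nonzero unfolding pos_def_form_def by simp
qed

text \<open>
  Cauchy-Schwarz for \<open>g\<close>, since \<open>l(y) = g(l, F y)\<close>. It bounds the control and, for coordinate functionals,
  the trajectories.
\<close>

lemma functional_bound: "(\<Sum>i<n. l i * y i)\<^sup>2 \<le> bform n g l l * bform n f y y"
proof -
  have "(\<Sum>i<n. l i * y i) = bform n g l (dual y)"
  proof -
    have "(\<Sum>i<n. l i * y i) = (\<Sum>i<n. l i * (\<Sum>k<n. g i k * dual y k))" by (simp add: primal)
    then show ?thesis unfolding bform_def sum_distrib_left by (simp only: mult_ac)
  qed
  then show ?thesis
    using pos_def_form_Cauchy_Schwarz[OF sym pd] by (simp add: bform_dual_self)
qed

lemma bform_scaled_drift:
  assumes antisym: "\<And>i j. i < n \<Longrightarrow> j < n \<Longrightarrow> drift_form n a g i j + drift_form n a g j i = 0"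
  shows "bform n f (scaled_drift n a y) y = 0"
proof -
  let ?S = "drift_form n a g" and ?p = "dual y"
  have "bform n f (scaled_drift n a y) y = bform n ?S ?p ?p"
  proof (rule bform_dual_map)
    fix i assume i: "i < n"
    have "(\<Sum>k<n. ?S i k * ?p k) = (\<Sum>k<n. (if i = 0 then \<Sum>l<n. a l * g l k else g (i - 1) k) * ?p k)
        + (real i + 1) * (\<Sum>k<n. g i k * ?p k)"
      unfolding drift_form_def sum_distrib_left sum.distrib[symmetric]
      by (intro sum.cong refl) (simp only: distrib_right mult.assoc)
    also have "(\<Sum>k<n. (if i = 0 then \<Sum>l<n. a l * g l k else g (i - 1) k) * ?p k)
        = (if i = 0 then \<Sum>l<n. a l * y l else y (i - 1))"
    proof (cases "i = 0")
      case True
      have "(\<Sum>k<n. (\<Sum>l<n. a l * g l k) * ?p k) = (\<Sum>l<n. a l * (\<Sum>k<n. g l k * ?p k))"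
        unfolding sum_distrib_left sum_distrib_right by (subst sum.swap) (simp only: mult.assoc)
      then show ?thesis using True primal by simp
    qed (use i primal in auto)
    finally show "scaled_drift n a y i = (\<Sum>k<n. ?S i k * ?p k)"
      using primal[OF i] by (simp add: scaled_drift_def)
  qed
  moreover have "bform n ?S ?p ?p + bform n ?S ?p ?p = bform n (\<lambda>i j. ?S i j + ?S j i) ?p ?p"
    unfolding bform_add_coeff by (subst (2) bform_swap) (rule refl)
  moreover have "bform n (\<lambda>i j. ?S i j + ?S j i) ?p ?p = 0"
    using antisym by (simp add: bform_def)
  ultimately show ?thesis by simp
qed

end

section \<open>Matrices and their forms\<close>

lemma mat_inv_eqI:
  assumes A: "A \<in> carrier_mat n n" and B: "B \<in> carrier_mat n n" and AB: "A * B = 1\<^sub>m n"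
  shows "mat_inv A = B"
proof -
  have BA: "B * A = 1\<^sub>m n" by (rule mat_mult_left_right_inverse[OF A B AB])
  have "A \<in> Units (ring_mat TYPE(real) n ())"
    unfolding Units_def ring_mat_def using A B AB BA by auto
  then obtain A' where A': "mat_inverse A = Some A'" using mat_inverse(1)[OF A, of "()"] by (cases "mat_inverse A") auto
  then have "A' * A = 1\<^sub>m n" "A' \<in> carrier_mat n n" using mat_inverse(2)[OF A] by auto
  then have "A' = A' * (A * B)" "(A' * A) * B = B" using AB B by auto
  then have "A' = B" using assoc_mult_mat[of A' n n A n B n] \<open>A' \<in> carrier_mat n n\<close> A B by simp
  then show ?thesis by (simp add: mat_inv_def A')
qed

lemma pos_def_form_det_nonzero:
  assumes A: "A \<in> carrier_mat n n" and pd: "pos_def_form n (\<lambda>i j. A $$ (i, j))"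
  shows "det A \<noteq> 0"
proof
  assume "det A = 0"
  then obtain v where v: "v \<in> carrier_vec n" "v \<noteq> 0\<^sub>v n" "A *\<^sub>v v = 0\<^sub>v n"
    using det_0_iff_vec_prod_zero_field[OF A] by blast
  then obtain k where k: "k < n" "v $ k \<noteq> 0" by (metis carrier_vecD eq_vecI index_zero_vec)
  have row: "(\<Sum>j<n. A $$ (i, j) * v $ j) = 0" if "i < n" for i
  proof -
    have "(A *\<^sub>v v) $ i = 0" using v(3) that by simp
    then show ?thesis using A v(1) that by (simp add: scalar_prod_def atLeast0LessThan)
  qed
  have "bform n (\<lambda>i j. A $$ (i, j)) (\<lambda>i. v $ i) (\<lambda>i. v $ i)
      = (\<Sum>i<n. v $ i * (\<Sum>j<n. A $$ (i, j) * v $ j))"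
    unfolding bform_def sum_distrib_left by (simp only: mult_ac)
  also have "\<dots> = 0" using row by simp
  finally show False using pos_def_formD[OF pd k(1), of "\<lambda>i. v $ i"] k(2) by simp
qed

lemma D_mat_eq: "D_mat n = mat_diag n D_coeff"
  unfolding D_mat_def mat1_def mat_diag_def by (intro eq_matI) (auto simp: D_coeff_def)

text \<open>
  Splitting off \<open>sqrt \<theta>\<close> shows that \<open>(D(\<theta>) F D(\<theta>) x, x)\<close> is \<open>\<theta>\<close> times the level at \<open>1 / \<theta>\<close>, so that a
  factor \<open>\<theta>\<close> cancels in the equation for \<open>\<Theta>\<close>.
\<close>

lemma D_Theta_eq:
  assumes "\<theta> > 0"
  shows "D_Theta n \<theta> = mat_diag n (\<lambda>i. sqrt \<theta> * (1 / \<theta>) ^ (i + 1))"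
proof -
  have "\<theta> powr (- ((2 * real (i + 1) - 1) / 2)) = sqrt \<theta> * (1 / \<theta>) ^ (i + 1)" for i
  proof -
    have "- ((2 * real (i + 1) - 1) / 2) = 1 / 2 - real (i + 1)" by (simp add: field_simps)
    then have "\<theta> powr (- ((2 * real (i + 1) - 1) / 2)) = \<theta> powr (1 / 2) / \<theta> powr real (i + 1)"
      by (simp only: powr_diff)
    also have "\<dots> = sqrt \<theta> / \<theta> ^ (i + 1)"
      using assms by (simp only: powr_half_sqrt[OF less_imp_le] powr_realpow)
    finally show ?thesis by (simp add: power_divide)
  qed
  then show ?thesis
    unfolding D_Theta_def mat1_def mat_diag_def by (simp only: add_right_cancel cong: if_cong)
qed

lemma mat_diag_sandwich:
  assumes "A \<in> carrier_mat n n" "i < n" "j < n"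
  shows "(mat_diag n d * A * mat_diag n e) $$ (i, j) = d i * A $$ (i, j) * e j"
  using assms by (simp add: mat_diag_mult_left mat_diag_mult_right[of _ n])

lemma quadratic_form_mat:
  assumes "A \<in> carrier_mat n n" "x \<in> carrier_vec n"
  shows "(A *\<^sub>v x) \<bullet> x = bform n (\<lambda>i j. A $$ (i, j)) (\<lambda>i. x $ i) (\<lambda>i. x $ i)"
  using assms
  by (simp add: scalar_prod_def bform_def atLeast0LessThan sum_distrib_right sum_distrib_left mult_ac)

lemma nonzero_vec_iff:
  assumes "x \<in> carrier_vec n"
  shows "x \<noteq> 0\<^sub>v n \<longleftrightarrow> (\<exists>i<n. x $ i \<noteq> 0)"
  using assms by (metis carrier_vecD eq_vecI index_zero_vec)

lemma canonical_system_component: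
  assumes "v \<in> carrier_vec n" "i < n"
  shows "(A0_mat n *\<^sub>v v + r \<cdot>\<^sub>v b0_vec n) $ i = (if i = 0 then r else v $ (i - 1))"
proof -
  have "(A0_mat n *\<^sub>v v) $ i = (\<Sum>j<n. (if i = j + 1 then 1 else 0) * v $ j)"
    using assms by (simp add: A0_mat_def mat1_def scalar_prod_def atLeast0LessThan)
  also have "\<dots> = (\<Sum>j<n. if j = i - 1 then (if i = 0 then 0 else v $ j) else 0)"
    by (intro sum.cong refl) auto
  also have "\<dots> = (if i = 0 then 0 else v $ (i - 1))" using assms(2) by simp
  finally show ?thesis using assms by (simp add: b0_vec_def vec1_def A0_mat_def mat1_def)
qed

section \<open>Transfer to the origin by the bounded control\<close>

theorem theorem3p1:
  fixes n :: nat
    and d an c \<xi>\<^sub>0 a\<^sub>0 :: real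
    and C F :: "real mat"
    and a :: "real vec"
    and \<Theta> u :: "real vec \<Rightarrow> real"
  assumes "n \<ge> 2"
    and "d > 0"
    and "c > 0"
    and "det (xi_mat n \<xi>\<^sub>0) = 0"
    and "kappa n an > max \<xi>\<^sub>0 ((1 / 2 + 1 / (2 * real n)) * \<xi>\<^sub>0 + 1 / 4 - 1 / (4 * real n))"
    and "C = C_mat n an c"
    and "a = a_vec n an"
    and "F = mat_inv (D_mat n) * mat_inv C * mat_inv (D_mat n)"
    and "0 < a\<^sub>0"
    and "a\<^sub>0 \<le> d ^ 2 / (2 * ((mat_inv F *\<^sub>v a) \<bullet> a))"
    and "\<Theta> = controllability_fun n F a\<^sub>0"
    and "u = control n a \<Theta>"
  shows "(\<forall>x\<in>carrier_vec n. x \<noteq> 0\<^sub>v n \<longrightarrow> (\<exists>!\<theta>. \<theta> > 0 \<and> Theta_eq n F a\<^sub>0 x \<theta>)) \<and>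
    (\<forall>x\<in>carrier_vec n. transfers_to_origin n u x (\<Theta> x)) \<and>
    (\<forall>x\<in>carrier_vec n. \<bar>u x\<bar> \<le> d)"
proof -
  define \<kappa> where "\<kappa> = kappa n an"
  define c' where "c' = (2 * real n - 1) * (2 * real n) * c"
  define g where "g = G_form c' \<kappa>"
  define \<alpha> where "\<alpha> i = a $ i" for i
  have n: "n > 0" and c': "c' > 0" using assms(1,3) by (auto simp: c'_def)
  have doubled: "(1 + 1 / real n) * \<xi>\<^sub>0 + 1 / 2 - 1 / (2 * real n)
      = 2 * ((1 / 2 + 1 / (2 * real n)) * \<xi>\<^sub>0 + 1 / 4 - 1 / (4 * real n))"
    using n by (simp add: field_simps)
  have "(1 / 2 + 1 / (2 * real n)) * \<xi>\<^sub>0 + 1 / 4 - 1 / (4 * real n) < \<kappa>"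
    using assms(5) by (simp add: \<kappa>_def)
  \<comment> \<open>Twice the second lower bound for \<open>\<kappa>\<close> is the corner entry of the singular matrix.\<close>
  then have threshold: "(1 + 1 / real n) * \<xi>\<^sub>0 + 1 / 2 - 1 / (2 * real n) < 2 * \<kappa>"
    unfolding doubled by (simp only: mult_less_cancel_left_pos zero_less_numeral)
  have g_pd: "pos_def_form n g" and g_damp: "pos_def_form n (\<lambda>i j. (real i + 1) * g i j)"
    unfolding g_def by (rule pos_def_form_G_form[OF n c' assms(4) threshold])+

  have C: "C \<in> carrier_mat n n" by (simp add: assms(6) C_mat_def mat1_def)
  have C_entry: "C $$ (i, j) = c' * C_core \<kappa> i j" if "i < n" "j < n" for i j
    using that by (simp add: assms(6) C_mat_def mat1_def C_core_def c'_def \<kappa>_def add_ac)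
  have D: "D_mat n \<in> carrier_mat n n" by (simp add: D_mat_eq)
  define G where "G = D_mat n * C * D_mat n"
  have G: "G \<in> carrier_mat n n" using C D by (simp add: G_def)
  have G_entry: "G $$ (i, j) = g i j" if "i < n" "j < n" for i j
    using that unfolding G_def D_mat_eq mat_diag_sandwich[OF C that]
    by (simp add: C_entry g_def G_form_def)
  have "pos_def_form n (\<lambda>i j. G $$ (i, j))"
    using g_pd G_entry unfolding pos_def_form_def bform_def by simp
  from pos_def_form_det_nonzero[OF G this] have "det G \<noteq> 0" .
  then have "det C \<noteq> 0" "det (D_mat n) \<noteq> 0" using C D by (auto simp: G_def det_mult)
  have right_inverse: "\<exists>B \<in> carrier_mat n n. A * B = 1\<^sub>m n"
    if "A \<in> carrier_mat n n" "det A \<noteq> 0" for A :: "real mat"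
    using det_non_zero_imp_unit[OF that, of "()"] unfolding Units_def ring_mat_def by auto
  obtain B where B: "B \<in> carrier_mat n n" "C * B = 1\<^sub>m n"
    using right_inverse[OF C \<open>det C \<noteq> 0\<close>] by blast
  obtain E where E: "E \<in> carrier_mat n n" "D_mat n * E = 1\<^sub>m n"
    using right_inverse[OF D \<open>det (D_mat n) \<noteq> 0\<close>] by blast
  have F_eq: "F = E * B * E"
    using mat_inv_eqI[OF C B] mat_inv_eqI[OF D E] by (simp add: assms(8))
  have F: "F \<in> carrier_mat n n" using B E by (simp add: F_eq)
  have GF: "G * F = 1\<^sub>m n"
  proof -
    have assoc: "X * Y * Z = X * (Y * Z)"
      if "X \<in> carrier_mat n n" "Y \<in> carrier_mat n n" "Z \<in> carrier_mat n n" for X Y Z :: "real mat"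
      using that by (rule assoc_mult_mat)
    have "G * F = D_mat n * (C * ((D_mat n * E) * (B * E)))"
      unfolding G_def F_eq using B(1) E(1) C D by (simp add: assoc)
    also have "\<dots> = D_mat n * (C * (B * E))" using B(1) E by simp
    also have "\<dots> = D_mat n * ((C * B) * E)" by (simp only: assoc[OF C B(1) E(1)])
    also have "\<dots> = 1\<^sub>m n" using B E by simp
    finally show ?thesis .
  qed
  have inv_F: "mat_inv F = G"
    by (rule mat_inv_eqI[OF F G mat_mult_left_right_inverse[OF G F GF]])
  define f where "f i j = F $$ (i, j)" for i j
  interpret inverse_forms n f g
  proof
    fix i j assume ij: "i < n" "j < n"
    have "(G * F) $$ (i, j) = (\<Sum>k<n. g i k * f k j)"
      using G F ij by (simp add: scalar_prod_def atLeast0LessThan G_entry f_def)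
    then show "(\<Sum>k<n. g i k * f k j) = (if i = j then 1 else 0)" using ij by (simp add: GF)
  qed (use g_pd G_form_sym in \<open>auto simp: g_def\<close>)

  have a: "a \<in> carrier_vec n" by (simp add: assms(7) a_vec_def vec1_def)
  interpret homogeneous_feedback n f \<alpha> "2 * a\<^sub>0"
  proof
    show "0 < 2 * a\<^sub>0" using assms(9) by simp
    show "bform n f x y = bform n f y x" for x y by (rule bform_f_commute)
    show "pos_def_form n f" by (rule pos_def_form_inverse)
    show "pos_def_form n (\<lambda>i j. (real i + 1) * f i j)"
      by (rule pos_def_form_inverse_damping[OF g_damp])
    show "bform n f (scaled_drift n \<alpha> y) y = 0" for y
      using drift_form_antisym[OF assms(1), of _ _ an c']
      by (intro bform_scaled_drift) (simp add: g_def \<alpha>_def[abs_def] \<kappa>_def assms(7))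
    show "\<exists>K. \<forall>y. (y i)\<^sup>2 \<le> K * bform n f y y" if "i < n" for i
      using functional_bound[of "\<lambda>k. if k = i then 1 else 0"] that
      by (intro exI) (auto simp: if_distrib[where f = "\<lambda>z. z * _"] cong: if_cong)
  qed

  define co where "co x = (\<lambda>i. x $ i :: real)" for x :: "real vec"
  have nonzero_co: "x \<noteq> 0\<^sub>v n \<longleftrightarrow> nonzero (co x)" if "x \<in> carrier_vec n" for x
    unfolding co_def by (rule nonzero_vec_iff[OF that])
  have Theta_eq_level: "Theta_eq n F a\<^sub>0 x \<theta> \<longleftrightarrow> level (co x) (1 / \<theta>) = 2 * a\<^sub>0"
    if x: "x \<in> carrier_vec n" and \<theta>: "\<theta> > 0" for x \<theta>
  proof -
    let ?D = "mat_diag n (\<lambda>i. sqrt \<theta> * (1 / \<theta>) ^ (i + 1))"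
    have "(?D * F * ?D *\<^sub>v x) \<bullet> x = bform n (\<lambda>i j. (?D * F * ?D) $$ (i, j)) (co x) (co x)"
      unfolding co_def by (intro quadratic_form_mat mult_carrier_mat[of _ n n _ n] mat_diag_dim F x)
    also have "\<dots> = bform n (\<lambda>i j. \<theta> * f i j) (rescale (co x) (1 / \<theta>)) (rescale (co x) (1 / \<theta>))"
    proof (rule bform_cong)
      fix i j assume ij: "i < n" "j < n"
      have root: "sqrt \<theta> * sqrt \<theta> = \<theta>" using \<theta> by simp
      have regroup: "r * p * m * (r * q) * v * w = (r * r) * m * (v * p) * (w * q)"
        for r p q m v w :: real by (simp only: mult_ac)
      show "(?D * F * ?D) $$ (i, j) * co x i * co x j
          = \<theta> * f i j * rescale (co x) (1 / \<theta>) i * rescale (co x) (1 / \<theta>) j"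
        unfolding mat_diag_sandwich[OF F ij] rescale_def f_def regroup root ..
    qed
    finally have "(?D * F * ?D *\<^sub>v x) \<bullet> x = \<theta> * level (co x) (1 / \<theta>)"
      unfolding bform_scale_coeff level_def .
    then show ?thesis unfolding Theta_eq_def D_Theta_eq[OF \<theta>] using \<theta> by auto
  qed
  have unique: "\<exists>!\<theta>. \<theta> > 0 \<and> Theta_eq n F a\<^sub>0 x \<theta>"
    and \<Theta>_eq: "\<Theta> x = 1 / rate (co x)"
    if x: "x \<in> carrier_vec n" "x \<noteq> 0\<^sub>v n" for x
  proof -
    have nz: "nonzero (co x)" using x nonzero_co by blast
    have iff: "\<theta> > 0 \<and> Theta_eq n F a\<^sub>0 x \<theta> \<longleftrightarrow> \<theta> = 1 / rate (co x)" for \<theta>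
    proof
      assume "\<theta> > 0 \<and> Theta_eq n F a\<^sub>0 x \<theta>"
      then have "rate (co x) = 1 / \<theta>" using Theta_eq_level[OF x(1)] by (intro rate_eqI[OF nz]) auto
      then show "\<theta> = 1 / rate (co x)" by simp
    next
      assume "\<theta> = 1 / rate (co x)"
      then show "\<theta> > 0 \<and> Theta_eq n F a\<^sub>0 x \<theta>"
        using rate_pos[OF nz] level_rate[OF nz] Theta_eq_level[OF x(1), of \<theta>] by simp
    qed
    then show "\<exists>!\<theta>. \<theta> > 0 \<and> Theta_eq n F a\<^sub>0 x \<theta>" by simp
    show "\<Theta> x = 1 / rate (co x)" using x(2) iff by (simp add: assms(11) controllability_fun_def)
  qed
  have \<Theta>_0: "\<Theta> (0\<^sub>v n) = 0" by (simp add: assms(11) controllability_fun_def)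
  have u_eq: "u x = (\<Sum>k<n. \<alpha> k * rescale (co x) (rate (co x)) k)"
    if x: "x \<in> carrier_vec n" "x \<noteq> 0\<^sub>v n" for x
  proof -
    have "u x = (\<Sum>k<n. a $ k * x $ k / \<Theta> x ^ (k + 1))"
      unfolding assms(12) control_def
      by (rule sum.reindex_bij_witness[of _ "\<lambda>k. k + 1" "\<lambda>k. k - 1"]) auto
    then show ?thesis unfolding \<Theta>_eq[OF x] by (simp add: \<alpha>_def rescale_def co_def power_divide mult.assoc)
  qed

  have "\<bar>u x\<bar> \<le> d" if x: "x \<in> carrier_vec n" for x
  proof (cases "x = 0\<^sub>v n")
    case True
    then have "u x = 0" by (auto simp: assms(12) control_def \<Theta>_0 intro!: sum.neutral)
    then show ?thesis using assms(2) by simp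
  next
    case False
    have Gaa: "(mat_inv F *\<^sub>v a) \<bullet> a = bform n g \<alpha> \<alpha>"
      unfolding inv_F quadratic_form_mat[OF G a]
      by (rule bform_cong) (simp add: G_entry \<alpha>_def)
    have "\<alpha> 0 = a_first n" using n by (simp add: \<alpha>_def assms(7) a_vec_def vec1_def)
    then have "\<alpha> 0 \<noteq> 0" using n by (simp add: a_first_def)
    then have pos: "bform n g \<alpha> \<alpha> > 0" by (rule pos_def_formD[OF g_pd n])
    have "(u x)\<^sup>2 \<le> bform n g \<alpha> \<alpha> * level (co x) (rate (co x))"
      unfolding u_eq[OF x False] level_def by (rule functional_bound)
    also have "\<dots> = bform n g \<alpha> \<alpha> * (2 * a\<^sub>0)"
      using level_rate nonzero_co[OF x] False by simp
    also have "\<dots> \<le> d\<^sup>2"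
      using assms(10)[unfolded Gaa] pos by (simp add: pos_le_divide_eq mult_ac)
    finally have "\<bar>u x\<bar> \<le> \<bar>d\<bar>" by (simp only: abs_le_square_iff)
    then show ?thesis using assms(2) by simp
  qed
  moreover have "transfers_to_origin n u x\<^sub>0 (\<Theta> x\<^sub>0)" if x0: "x\<^sub>0 \<in> carrier_vec n" for x\<^sub>0
  proof (cases "x\<^sub>0 = 0\<^sub>v n")
    case True
    have "\<not> closed_loop_solution n u x\<^sub>0 s \<psi>" if "s > 0" for s \<psi>
    proof
      assume "closed_loop_solution n u x\<^sub>0 s \<psi>"
      then have "\<psi> 0 = 0\<^sub>v n" "\<forall>t\<in>{0..<s}. \<psi> t \<noteq> 0\<^sub>v n"
        using True by (simp_all add: closed_loop_solution_def)
      then show False using that by force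
    qed
    moreover have "closed_loop_solution n u x\<^sub>0 0 (\<lambda>_. 0\<^sub>v n)"
      using True by (simp add: closed_loop_solution_def)
    moreover have "\<Theta> x\<^sub>0 = 0" using True \<Theta>_0 by simp
    ultimately show ?thesis
      unfolding transfers_to_origin_def
      by (intro conjI exI[of _ "\<lambda>_. 0\<^sub>v n"]) simp_all
  next
    case False
    define T where "T = \<Theta> x\<^sub>0"
    have nz: "nonzero (co x\<^sub>0)" using False nonzero_co[OF x0] by blast
    have T: "T = 1 / rate (co x\<^sub>0)" unfolding T_def by (rule \<Theta>_eq[OF x0 False])
    have T_pos: "T > 0" using rate_pos[OF nz] by (simp add: T)
    obtain \<phi> where \<phi>: "\<And>i. \<phi> 0 i = co x\<^sub>0 i" "solution T \<phi>" "\<And>i. \<phi> T i = 0"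
      "\<And>i. i < n \<Longrightarrow> continuous_on {0..T} (\<lambda>t. \<phi> t i)"
      unfolding T using solution_exists[OF nz] by blast
    have to_solution: "solution s (\<lambda>t. co (\<psi> t))" if "closed_loop_solution n u x\<^sub>0 s \<psi>" for s \<psi>
      unfolding solution_def
    proof (intro ballI conjI allI impI)
      fix t assume t: "t \<in> {0..<s}"
      have \<psi>: "\<psi> t \<in> carrier_vec n" "\<psi> t \<noteq> 0\<^sub>v n"
        using that t unfolding closed_loop_solution_def by auto
      show "nonzero (co (\<psi> t))" using \<psi> nonzero_co by blast
      fix i assume i: "i < n"
      have "((\<lambda>\<tau>. \<psi> \<tau> $ i) has_real_derivative
          (A0_mat n *\<^sub>v \<psi> t + u (\<psi> t) \<cdot>\<^sub>v b0_vec n) $ i) (at t within {0..<s})"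
        using that t i unfolding closed_loop_solution_def by blast
      then show "((\<lambda>\<tau>. co (\<psi> \<tau>) i) has_real_derivative
          (if i = 0 then \<Sum>k<n. \<alpha> k * rescale (co (\<psi> t)) (rate (co (\<psi> t))) k else co (\<psi> t) (i - 1)))
          (at t within {0..<s})"
        unfolding canonical_system_component[OF \<psi>(1) i] u_eq[OF \<psi>] co_def .
    qed
    define \<Phi> where "\<Phi> t = vec n (\<phi> t)" for t
    have co_\<Phi>: "co (\<Phi> t) i = \<phi> t i" if "i < n" for t i using that by (simp add: co_def \<Phi>_def)
    have level_\<Phi>: "level (co (\<Phi> t)) = level (\<phi> t)" for t
      unfolding level_def[abs_def] by (intro ext bform_cong) (simp add: rescale_def co_\<Phi>)
    have rate_\<Phi>: "rate (co (\<Phi> t)) = rate (\<phi> t)" for t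
      unfolding rate_def level_\<Phi> ..
    have "closed_loop_solution n u x\<^sub>0 T \<Phi>"
      unfolding closed_loop_solution_def
    proof (intro conjI ballI allI impI)
      show "\<Phi> 0 = x\<^sub>0" using x0 by (intro eq_vecI) (auto simp: \<Phi>_def \<phi>(1) co_def)
      fix t assume t: "t \<in> {0..<T}"
      show \<Phi>: "\<Phi> t \<in> carrier_vec n" by (simp add: \<Phi>_def)
      have "nonzero (\<phi> t)" using \<phi>(2) t by (auto simp: solution_def)
      then show \<Phi>0: "\<Phi> t \<noteq> 0\<^sub>v n" unfolding nonzero_co[OF \<Phi>] using co_\<Phi> by auto
      fix i assume i: "i < n"
      have "((\<lambda>\<tau>. \<phi> \<tau> i) has_real_derivative
        (if i = 0 then \<Sum>k<n. \<alpha> k * rescale (\<phi> t) (rate (\<phi> t)) k else \<phi> t (i - 1))) (at t within {0..<T})"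
        using \<phi>(2) t i unfolding solution_def by blast
      moreover have "(if i = 0 then \<Sum>k<n. \<alpha> k * rescale (\<phi> t) (rate (\<phi> t)) k else \<phi> t (i - 1))
          = (A0_mat n *\<^sub>v \<Phi> t + u (\<Phi> t) \<cdot>\<^sub>v b0_vec n) $ i"
        unfolding canonical_system_component[OF \<Phi> i] u_eq[OF \<Phi> \<Phi>0] rate_\<Phi>
        using i by (simp add: rescale_def co_\<Phi>) (simp add: \<Phi>_def)
      ultimately show "((\<lambda>\<tau>. \<Phi> \<tau> $ i) has_real_derivative
          (A0_mat n *\<^sub>v \<Phi> t + u (\<Phi> t) \<cdot>\<^sub>v b0_vec n) $ i) (at t within {0..<T})"
        using i by (simp add: \<Phi>_def)
    qed
    moreover have "s \<le> T \<and> (\<forall>t\<in>{0..<s}. \<psi> t = \<Phi> t)"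
      if s: "s > 0" and \<psi>: "closed_loop_solution n u x\<^sub>0 s \<psi>" for s \<psi>
    proof
      note sol = to_solution[OF \<psi>]
      have \<psi>0: "co (\<psi> 0) = co x\<^sub>0" using \<psi> by (simp add: closed_loop_solution_def)
      show sT: "s \<le> T" using solution_time_bound[OF sol s] by (simp add: \<psi>0 T)
      have init: "\<phi> 0 = co x\<^sub>0" by (intro ext \<phi>(1))
      show "\<forall>t\<in>{0..<s}. \<psi> t = \<Phi> t"
      proof
        fix t assume t: "t \<in> {0..<s}"
        have "co (\<psi> t) i = \<phi> t i" if "i < n" for i
          by (rule solution_unique[OF sol solution_restrict[OF \<phi>(2) sT] _ _ t that])
            (simp_all add: \<psi>0 init)
        moreover have "\<psi> t \<in> carrier_vec n" using \<psi> t by (simp add: closed_loop_solution_def)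
        ultimately show "\<psi> t = \<Phi> t" by (intro eq_vecI) (auto simp: \<Phi>_def co_def)
      qed
    qed
    ultimately show ?thesis
      unfolding transfers_to_origin_def T_def[symmetric]
      using T_pos \<phi>(3,4) by (intro conjI exI[of _ \<Phi>]) (auto simp: \<Phi>_def)
  qed
  ultimately show ?thesis using unique by blast
qed

end
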